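(* Let $G$ be a finite group, let $\mathcal{K}$ be a $G$-invariant partition of $G$, and let $\mathcal{X}$ be a partition of $\operatorname{Irr} G$. Then: (a) $|\mathcal{K}| \leq |\operatorname{IrPt}(\mathcal{K})|$, and equality holds if and only if $(\operatorname{IrPt}(\mathcal{K}), \mathcal{K})$ is a supercharacter theory of $G$. (b) $|\mathcal{X}| \leq |\operatorname{ClPt}(\mathcal{X})|$, and equality holds if and only if $(\mathcal{X}, \operatorname{ClPt}(\mathcal{X}))$ is a supercharacter theory of $G$. (c) The partition $\operatorname{ClPt}(\operatorname{IrPt}(\mathcal{K}))$ refines $\mathcal{K}$, and these partitions are equal if and only if $(\operatorname{IrPt}(\mathcal{K}), \mathcal{K})$ is a supercharacter theory of $G$. (d) The partition $\operatorname{IrPt}(\operatorname{ClPt}(\mathcal{X}))$ refines $\mathcal{X}$, and these partitions are equal if and only if $(\mathcal{X}, \operatorname{ClPt}(\mathcal{X}))$ is a supercharacter theory of $G$.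
   Context: $\operatorname{Irr} G$ is the set of irreducible complex characters of the finite group $G$. For $X \subseteq \operatorname{Irr} G$ put $\sigma_X = \sum_{\chi \in X} \chi(1)\chi$. For $K \subseteq G$ put $\hat{K} = \sum_{g \in K} g \in \mathbb{C}G$; characters are extended linearly to $\mathbb{C}G$, so $\chi(\hat K)=\sum_{g\in K}\chi(g)$. A subset of $G$ is called normal or $G$-invariant if it is a union of conjugacy classes of $G$; a partition of $G$ is $G$-invariant if all its members are $G$-invariant. A partition $\mathcal{K}$ refines (is finer than) a partition $\mathcal{L}$ of the same set if every block of $\mathcal{K}$ is contained in a block of $\mathcal{L}$ (equality allowed). Supercharacter theory: a pair $(\mathcal{X},\mathcal{K})$ with $\mathcal{X}$ a partition of $\operatorname{Irr} G$ and $\mathcal{K}$ a partition of $G$ such that $|\mathcal{X}| = |\mathcal{K}|$ and, for every $X \in \mathcal{X}$, the character $\sigma_X$ is constant on each member of $\mathcal{K}$. For a collection $\mathcal{X}$ of subsets of $\operatorname{Irr} G$, $\operatorname{ClPt}(\mathcal{X})$ is the partition of $G$ into equivalence classes of the relation: $g \sim h$ if and only if $\sigma_X(g) = \sigma_X(h)$ for all $X \in \mathcal{X}$. For a collection $\mathcal{K}$ of $G$-invariant subsets of $G$, $\operatorname{IrPt}(\mathcal{K})$ is the partition of $\operatorname{Irr} G$ into equivalence classes of the relation: $\chi \sim \psi$ if and only if $\chi(\hat{K})/\chi(1) = \psi(\hat{K})/\psi(1)$ for all $K \in \mathcal{K}$. *)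

theory Defs
  imports
    "HOL-Algebra.Group"
    "HOL-Library.Disjoint_Sets"
    "Jordan_Normal_Form.VS_Connect"
begin

text \<open>A complex representation of degree \<open>n\<close> is a homomorphism into \<open>GL\<^sub>n(\<complex>)\<close>, the unit group of
  the matrix ring.\<close>

definition is_rep :: "('a, 'b) monoid_scheme \<Rightarrow> nat \<Rightarrow> ('a \<Rightarrow> complex mat) \<Rightarrow> bool" where
  "is_rep G n \<rho> \<longleftrightarrow> \<rho> \<in> hom G (units_of (ring_mat TYPE(complex) n ()))"

definition invariant_subspace ::
    "('a, 'b) monoid_scheme \<Rightarrow> nat \<Rightarrow> ('a \<Rightarrow> complex mat) \<Rightarrow> complex vec set \<Rightarrow> bool" where
  "invariant_subspace G n \<rho> W \<longleftrightarrow>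
     VectorSpace.subspace class_ring W (module_vec TYPE(complex) n) \<and>
     (\<forall>g\<in>carrier G. \<forall>w\<in>W. \<rho> g *\<^sub>v w \<in> W)"

definition irreducible_rep :: "('a, 'b) monoid_scheme \<Rightarrow> nat \<Rightarrow> ('a \<Rightarrow> complex mat) \<Rightarrow> bool" where
  "irreducible_rep G n \<rho> \<longleftrightarrow> is_rep G n \<rho> \<and> n > 0 \<and>
     (\<forall>W. invariant_subspace G n \<rho> W \<longrightarrow> W = {0\<^sub>v n} \<or> W = carrier_vec n)"

text \<open>Characters are made extensional, so that equality of characters is equality on the group.\<close>

definition rep_character ::
    "('a, 'b) monoid_scheme \<Rightarrow> ('a \<Rightarrow> complex mat) \<Rightarrow> 'a \<Rightarrow> complex" where
  "rep_character G \<rho> = (\<lambda>g\<in>carrier G. \<Sum>i<dim_row (\<rho> g). \<rho> g $$ (i, i))"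

definition Irr :: "('a, 'b) monoid_scheme \<Rightarrow> ('a \<Rightarrow> complex) set" where
  "Irr G = {rep_character G \<rho> | n \<rho>. irreducible_rep G n \<rho>}"

definition sigma :: "('a, 'b) monoid_scheme \<Rightarrow> ('a \<Rightarrow> complex) set \<Rightarrow> 'a \<Rightarrow> complex" where
  "sigma G X g = (\<Sum>\<chi>\<in>X. \<chi> \<one>\<^bsub>G\<^esub> * \<chi> g)"

definition conj_class :: "('a, 'b) monoid_scheme \<Rightarrow> 'a \<Rightarrow> 'a set" where
  "conj_class G g = {x \<otimes>\<^bsub>G\<^esub> g \<otimes>\<^bsub>G\<^esub> inv\<^bsub>G\<^esub> x | x. x \<in> carrier G}"

definition G_invariant :: "('a, 'b) monoid_scheme \<Rightarrow> 'a set \<Rightarrow> bool" where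
  "G_invariant G K \<longleftrightarrow> (\<exists>S \<subseteq> carrier G. K = (\<Union>g\<in>S. conj_class G g))"

definition supercharacter_theory ::
    "('a, 'b) monoid_scheme \<Rightarrow> ('a \<Rightarrow> complex) set set \<Rightarrow> 'a set set \<Rightarrow> bool" where
  "supercharacter_theory G XX KK \<longleftrightarrow>
     partition_on (Irr G) XX \<and> partition_on (carrier G) KK \<and> card XX = card KK \<and>
     (\<forall>X\<in>XX. \<forall>K\<in>KK. \<forall>g\<in>K. \<forall>h\<in>K. sigma G X g = sigma G X h)"

definition ClPt :: "('a, 'b) monoid_scheme \<Rightarrow> ('a \<Rightarrow> complex) set set \<Rightarrow> 'a set set" where
  "ClPt G XX = carrier G //
     {(g, h) \<in> carrier G \<times> carrier G. \<forall>X\<in>XX. sigma G X g = sigma G X h}"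

text \<open>The value of the linear extension of \<open>\<chi>\<close> to the group algebra at \<open>\<Sum>g\<in>K. g\<close> is
  \<open>\<Sum>g\<in>K. \<chi> g\<close>.\<close>

definition IrPt :: "('a, 'b) monoid_scheme \<Rightarrow> 'a set set \<Rightarrow> ('a \<Rightarrow> complex) set set" where
  "IrPt G KK = Irr G //
     {(\<chi>, \<psi>) \<in> Irr G \<times> Irr G.
        \<forall>K\<in>KK. (\<Sum>g\<in>K. \<chi> g) / \<chi> \<one>\<^bsub>G\<^esub> = (\<Sum>g\<in>K. \<psi> g) / \<psi> \<one>\<^bsub>G\<^esub>}"

end

theory Submission
  imports Defs "Jordan_Normal_Form.Schur_Decomposition"
begin

text \<open>The link between partitions of \<open>G\<close> and partitions of \<open>Irr G\<close> is a Fourier transform. A class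
  function \<open>f\<close> is sent to the function \<open>\<chi> \<mapsto> omega \<chi> f\<close> on \<open>Irr G\<close>, where \<open>omega \<chi> f\<close> is the scalar
  by which the central element \<open>\<Sum>g. f g g\<close> of the group algebra acts in a representation with
  character \<open>\<chi>\<close>. Two families of functions correspond under it. The indicator of a normal set \<open>K\<close>
  becomes the family of values \<open>\<chi>(K)/\<chi>(1)\<close> that defines \<open>IrPt\<close>; and the coefficient function of the
  central idempotent belonging to \<open>X \<subseteq> Irr G\<close>, which is the complex conjugate of \<open>\<sigma>\<^sub>X\<close> divided by
  the group order, becomes the indicator of \<open>X\<close> (lemma \<open>omega_idem_coeff\<close>). The transform is
  injective, and this gives the inversion formula \<open>fourier_inversion\<close>.

  Let a partition \<open>\<K>\<close> of \<open>G\<close> into normal sets and a partition \<open>\<X>\<close> of \<open>Irr G\<close> be such that every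
  \<open>\<chi>(K)/\<chi>(1)\<close> is constant on the members of \<open>\<X>\<close>. The indicators of the members of \<open>\<K>\<close> are linearly
  independent, so their transforms are \<open>|\<K>|\<close> independent vectors in the space of functions constant on
  the members of \<open>\<X>\<close>, and \<open>|\<K>| \<le> |\<X>|\<close>. If equality holds, then they span that space. The indicators of
  the members of \<open>\<X>\<close> are then transforms of functions constant on the members of \<open>\<K>\<close>, which says
  that every \<open>\<sigma>\<^sub>X\<close> is constant on the members of \<open>\<K>\<close> (lemma \<open>omega_constant_card\<close>). The same argument with
  the two sides exchanged starts from constant \<open>\<sigma>\<^sub>X\<close> (lemma \<open>sigma_constant_card\<close>). Parts (a) and (b)
  are the cases \<open>\<X> = IrPt \<K>\<close> and \<open>\<K> = ClPt \<X>\<close>. For the refinements in (c) and (d), the indicator of a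
  block is written as a combination of functions that do not separate equivalent elements, in (c) by
  inversion and in (d) by transforming an idempotent (lemmas \<open>same_sigma_same_block\<close> and \<open>same_omega_same_block\<close>). The statements about equality in
  (c) and (d) then follow by combining these refinements with the two comparisons of cardinalities.

  The character theory behind the transform is built from matrices. Schur's lemma, applied to averages
  of matrix units, gives the orthogonality relations. Injectivity of the transform is the completeness
  of the irreducible characters (lemma \<open>class_function_eq_zero\<close>): a class function \<open>f\<close> orthogonal to all
  of them acts as zero in every irreducible representation, and so does the convolution \<open>b\<close> of \<open>f\<close> with
  its adjoint. In the regular representation \<open>b\<close> has trace \<open>|G| \<Sum>g. |f g|\<^sup>2\<close>. If \<open>f\<close> were not zero,
  \<open>b\<close> would have a nonzero eigenvalue there; its eigenspace is invariant and contains an irreducible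
  subrepresentation, on which \<open>b\<close> would act both as that eigenvalue and as zero.\<close>

section \<open>Matrices with trivial kernel\<close>

definition inj_mat :: "nat \<Rightarrow> nat \<Rightarrow> complex mat \<Rightarrow> bool" where
  "inj_mat r c A \<longleftrightarrow> A \<in> carrier_mat r c \<and> (\<forall>v\<in>carrier_vec c. A *\<^sub>v v = 0\<^sub>v r \<longrightarrow> v = 0\<^sub>v c)"

text \<open>A matrix with more columns than rows becomes square when zero rows are added below it. Its determinant
  is then zero, and a kernel vector of the square matrix is one of the original matrix.\<close>

lemma inj_mat_dim_le:
  assumes "inj_mat r c A"
  shows "c \<le> r"
proof (rule ccontr)
  assume "\<not> c \<le> r"
  then have rc: "r < c" by simp
  have A: "A \<in> carrier_mat r c" and inj: "\<And>v. v \<in> carrier_vec c \<Longrightarrow> A *\<^sub>v v = 0\<^sub>v r \<Longrightarrow> v = 0\<^sub>v c"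
    using assms by (auto simp: inj_mat_def)
  define B where "B = mat c c (\<lambda>(i, j). if i < r then A $$ (i, j) else 0)"
  have B: "B \<in> carrier_mat c c" by (simp add: B_def)
  have "B = mat\<^sub>r c c (\<lambda>i. if i = r then 0\<^sub>v c else row B i)"
    by (rule eq_matI) (auto simp: B_def)
  also have "det \<dots> = 0"
    by (rule det_row_0) (use rc B in auto)
  finally obtain v where v: "v \<in> carrier_vec c" "v \<noteq> 0\<^sub>v c" "B *\<^sub>v v = 0\<^sub>v c"
    using det_0_iff_vec_prod_zero[OF B] by auto
  have "A *\<^sub>v v = 0\<^sub>v r"
  proof (rule eq_vecI)
    fix i assume i: "i < dim_vec (0\<^sub>v r :: complex vec)"
    then have "row A i = row B i" using A rc by (intro eq_vecI) (auto simp: B_def)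
    moreover have "(B *\<^sub>v v) $ i = 0" using v(3) i rc by simp
    ultimately show "(A *\<^sub>v v) $ i = 0\<^sub>v r $ i" using i rc A B by simp
  qed (use A in simp)
  with inj v show False by blast
qed

lemma inj_mat_square_inverse:
  assumes "inj_mat n n A"
  obtains B where "B \<in> carrier_mat n n" "A * B = 1\<^sub>m n" "B * A = 1\<^sub>m n"
proof -
  have A: "A \<in> carrier_mat n n" using assms by (simp add: inj_mat_def)
  have "det A \<noteq> 0"
    using assms det_0_iff_vec_prod_zero[OF A] by (auto simp: inj_mat_def)
  from det_non_zero_imp_unit[OF A this, of "()"] show thesis
    using that by (auto simp: Units_def ring_mat_simps)
qed

text \<open>The closure properties of a subspace of \<open>\<complex>\<^sup>n\<close>, without the record structure of the module of
  vectors; \<open>vec_subspace_iff\<close> links them to the notion that defines irreducibility.\<close>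

definition vec_subspace :: "nat \<Rightarrow> complex vec set \<Rightarrow> bool" where
  "vec_subspace n W \<longleftrightarrow> W \<subseteq> carrier_vec n \<and> 0\<^sub>v n \<in> W \<and>
     (\<forall>v\<in>W. \<forall>w\<in>W. v + w \<in> W) \<and> (\<forall>c. \<forall>w\<in>W. c \<cdot>\<^sub>v w \<in> W)"

lemma vec_subspace_iff: "VectorSpace.subspace class_ring W (module_vec TYPE(complex) n) \<longleftrightarrow> vec_subspace n W"
proof
  assume "VectorSpace.subspace class_ring W (module_vec TYPE(complex) n)"
  then have "submodule class_ring W (module_vec TYPE(complex) n)"
    by (simp add: VectorSpace.subspace_def)
  then show "vec_subspace n W"
    by (auto simp: submodule_def vec_subspace_def module_vec_simps)
next
  assume W: "vec_subspace n W"
  interpret vectorspace class_ring "module_vec TYPE(complex) n" by (rule vec_vs)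
  show "VectorSpace.subspace class_ring W (module_vec TYPE(complex) n)"
    unfolding VectorSpace.subspace_def submodule_def
    using W vec_vs[of n] vec_module[of n]
    by (auto simp: vec_subspace_def module_vec_simps)
qed

text \<open>This is the choice of a basis, with the basis vectors as the columns of \<open>Q\<close>. Among the injective
  matrices whose range lies in \<open>W\<close>, one with the largest number of columns must have range \<open>W\<close>:
  a vector of \<open>W\<close> outside the range could be added as a further column.\<close>

lemma vec_subspace_eq_range:
  assumes W: "vec_subspace n W"
  obtains e Q where "inj_mat n e Q" "W = {Q *\<^sub>v v | v. v \<in> carrier_vec e}"
proof -
  define P where "P e \<longleftrightarrow> (\<exists>Q. inj_mat n e Q \<and> (\<forall>v\<in>carrier_vec e. Q *\<^sub>v v \<in> W))" for e
  have P0: "P 0"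
  proof -
    have "0\<^sub>m n 0 *\<^sub>v v \<in> W" if "v \<in> carrier_vec 0" for v :: "complex vec"
    proof -
      have "0\<^sub>m n 0 *\<^sub>v v = 0\<^sub>v n" using that by (intro eq_vecI) (auto simp: scalar_prod_def)
      then show ?thesis using W by (simp add: vec_subspace_def)
    qed
    then show ?thesis unfolding P_def inj_mat_def by (intro exI[of _ "0\<^sub>m n 0"]) auto
  qed
  have bound: "e \<le> n" if "P e" for e
    using that inj_mat_dim_le by (auto simp: P_def)
  define e where "e = (GREATEST e. P e)"
  have Pe: "P e" unfolding e_def using P0 bound by (rule GreatestI_nat)
  have max: "e' \<le> e" if "P e'" for e'
    unfolding e_def using that bound by (rule Greatest_le_nat)
  from Pe obtain Q where Q: "inj_mat n e Q" "\<And>v. v \<in> carrier_vec e \<Longrightarrow> Q *\<^sub>v v \<in> W"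
    by (auto simp: P_def)
  have Qc: "Q \<in> carrier_mat n e" using Q by (simp add: inj_mat_def)
  have "w \<in> {Q *\<^sub>v v | v. v \<in> carrier_vec e}" if wW: "w \<in> W" for w
  proof (rule ccontr)
    assume w: "w \<notin> {Q *\<^sub>v v | v. v \<in> carrier_vec e}"
    have wc: "w \<in> carrier_vec n" using wW W by (auto simp: vec_subspace_def)
    define Q' where "Q' = mat n (Suc e) (\<lambda>(i, j). if j < e then Q $$ (i, j) else w $ i)"
    have Q'v: "Q' *\<^sub>v v = Q *\<^sub>v vec e (\<lambda>i. v $ i) + v $ e \<cdot>\<^sub>v w"
      if "v \<in> carrier_vec (Suc e)" for v
      using that Qc wc by (intro eq_vecI) (auto simp: Q'_def scalar_prod_def mult.commute)
    have "Q' *\<^sub>v v \<in> W" if v: "v \<in> carrier_vec (Suc e)" for v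
      using W wW Q(2)[of "vec e (\<lambda>i. v $ i)"] by (auto simp: Q'v[OF v] vec_subspace_def)
    moreover have "inj_mat n (Suc e) Q'"
      unfolding inj_mat_def
    proof (intro conjI ballI impI)
      show "Q' \<in> carrier_mat n (Suc e)" by (simp add: Q'_def)
      fix v assume v: "v \<in> carrier_vec (Suc e)" and 0: "Q' *\<^sub>v v = 0\<^sub>v n"
      let ?u = "vec e (\<lambda>i. v $ i)"
      have Qu: "Q *\<^sub>v ?u \<in> carrier_vec n" using Qc by auto
      have ve: "v $ e = 0"
      proof (rule ccontr)
        assume ne: "v $ e \<noteq> 0"
        have "w = Q *\<^sub>v ((- 1 / v $ e) \<cdot>\<^sub>v ?u)"
        proof (rule eq_vecI)
          fix i assume "i < dim_vec (Q *\<^sub>v ((- 1 / v $ e) \<cdot>\<^sub>v ?u))"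
          then have i: "i < n" using Qc by auto
          have "(Q *\<^sub>v ?u) $ i + v $ e * w $ i = 0"
            using arg_cong[OF 0, of "\<lambda>x. x $ i"] Q'v[OF v] i Qu wc Qc by simp
          then have "w $ i = (- 1 / v $ e) * (Q *\<^sub>v ?u) $ i"
            using ne by (simp add: field_simps add_eq_0_iff)
          then show "w $ i = (Q *\<^sub>v ((- 1 / v $ e) \<cdot>\<^sub>v ?u)) $ i"
            using i Qc Qu by (simp add: mult_mat_vec)
        qed (use wc Qc in auto)
        then show False using w by auto
      qed
      moreover have "0 \<cdot>\<^sub>v w = 0\<^sub>v n" using wc by (intro eq_vecI) auto
      ultimately have "Q *\<^sub>v ?u = 0\<^sub>v n"
        using 0 Q'v[OF v] Qu wc by simp
      then have "?u = 0\<^sub>v e" using Q(1) by (auto simp: inj_mat_def)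
      then have "v $ i = 0" if "i < e" for i
        using that by (metis index_vec index_zero_vec(1))
      then show "v = 0\<^sub>v (Suc e)" using ve v
        by (intro eq_vecI) (auto simp: less_Suc_eq)
    qed
    ultimately have "P (Suc e)" by (auto simp: P_def)
    then show False using max by fastforce
  qed
  then have "W = {Q *\<^sub>v v | v. v \<in> carrier_vec e}" using Q(2) by auto
  with Q(1) show thesis by (rule that)
qed

lemma mat_eq_if_mult_vec_eq:
  fixes A :: "complex mat"
  assumes A: "A \<in> carrier_mat m n" and B: "B \<in> carrier_mat m n"
    and eq: "\<And>v. v \<in> carrier_vec n \<Longrightarrow> A *\<^sub>v v = B *\<^sub>v v"
  shows "A = B"
proof (rule eq_matI)
  fix i j assume ij: "i < dim_row B" "j < dim_col B"
  have "(A *\<^sub>v unit_vec n j) $ i = (B *\<^sub>v unit_vec n j) $ i" by (subst eq) auto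
  then show "A $$ (i, j) = B $$ (i, j)" using ij A B by simp
qed (use A B in auto)

lemma inj_mat_cancel:
  assumes Q: "inj_mat r c Q" and A: "A \<in> carrier_mat c k" and B: "B \<in> carrier_mat c k"
    and eq: "Q * A = Q * B"
  shows "A = B"
proof (rule mat_eq_if_mult_vec_eq[OF A B])
  have Qc: "Q \<in> carrier_mat r c" using Q by (simp add: inj_mat_def)
  fix v :: "complex vec" assume v: "v \<in> carrier_vec k"
  have Av: "A *\<^sub>v v \<in> carrier_vec c" and Bv: "B *\<^sub>v v \<in> carrier_vec c" using A B v by auto
  have "Q *\<^sub>v (A *\<^sub>v v) = Q *\<^sub>v (B *\<^sub>v v)"
    using eq Qc A B v by (metis assoc_mult_mat_vec)
  then have "Q *\<^sub>v (A *\<^sub>v v - B *\<^sub>v v) = 0\<^sub>v r"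
    using Qc Av Bv by (simp add: mult_minus_distrib_mat_vec)
  then have "A *\<^sub>v v - B *\<^sub>v v = 0\<^sub>v c" using Q Av Bv by (auto simp: inj_mat_def)
  then have "(A *\<^sub>v v) $ i - (B *\<^sub>v v) $ i = 0" if "i < c" for i
    using that Av Bv by (metis carrier_vecD index_minus_vec(1) index_zero_vec(1))
  then have "(A *\<^sub>v v) $ i = (B *\<^sub>v v) $ i" if "i < c" for i
    using that by simp
  then show "A *\<^sub>v v = B *\<^sub>v v"
    by (intro eq_vecI) (use carrier_vecD[OF Av] carrier_vecD[OF Bv] in metis)+
qed

lemma inj_mat_mult:
  assumes "inj_mat r c P" "inj_mat c k Q"
  shows "inj_mat r k (P * Q)"
  using assms by (auto simp: inj_mat_def assoc_mult_mat_vec[of P r c Q k])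

text \<open>Solving one linear system for each column of \<open>A\<close> at once. It turns an invariance statement about
  subspaces into an equation between matrices.\<close>

lemma factor_through_columns:
  fixes Q :: "complex mat"
  assumes Q: "Q \<in> carrier_mat r c" and A: "A \<in> carrier_mat r k"
    and sol: "\<And>j. j < k \<Longrightarrow> \<exists>v\<in>carrier_vec c. Q *\<^sub>v v = col A j"
  obtains M where "M \<in> carrier_mat c k" "A = Q * M"
proof -
  from sol obtain s where s: "\<And>j. j < k \<Longrightarrow> s j \<in> carrier_vec c \<and> Q *\<^sub>v s j = col A j" by metis
  define M where "M = mat c k (\<lambda>(i, j). s j $ i)"
  have colM: "col M j = s j" if "j < k" for j
    using s[OF that] that by (intro eq_vecI) (auto simp: M_def)
  have M: "M \<in> carrier_mat c k" by (simp add: M_def)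
  have "A = Q * M"
  proof (rule eq_matI)
    fix i j assume "i < dim_row (Q * M)" "j < dim_col (Q * M)"
    then have ij: "i < r" "j < k" using Q M by auto
    then have "(Q * M) $$ (i, j) = (Q *\<^sub>v s j) $ i" using Q M colM by auto
    then show "A $$ (i, j) = (Q * M) $$ (i, j)" using s[OF ij(2)] ij A by simp
  qed (use Q M A in auto)
  with M show thesis by (rule that)
qed

text \<open>Linear independence of \<open>f\<close> over \<open>I\<close> says that the matrix with entries \<open>f i p\<close> is injective. This bounds
  the number of its columns by the number of its rows; in the square case the matrix is invertible, so
  the functions span all functions on \<open>P\<close>.\<close>

lemma independent_functions_card:
  fixes f :: "'i \<Rightarrow> 'p \<Rightarrow> complex"
  assumes I: "finite I" and P: "finite P"
    and indep: "\<And>c i. (\<forall>p\<in>P. (\<Sum>i\<in>I. c i * f i p) = 0) \<Longrightarrow> i \<in> I \<Longrightarrow> c i = 0"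
  shows "card I \<le> card P"
    and "card I = card P \<Longrightarrow> \<exists>c. \<forall>p\<in>P. (\<Sum>i\<in>I. c i * f i p) = h p"
proof -
  let ?m = "card I" and ?k = "card P"
  obtain a where a: "bij_betw a {0..<?m} I" using ex_bij_betw_nat_finite[OF I] by blast
  obtain b where b: "bij_betw b {0..<?k} P" using ex_bij_betw_nat_finite[OF P] by blast
  define A where "A = mat ?k ?m (\<lambda>(r, s). f (a s) (b r))"
  have Ac: "A \<in> carrier_mat ?k ?m" by (simp add: A_def)
  define C where "C v i = v $ (inv_into {0..<?m} a i)" for v :: "complex vec" and i
  have C: "C v (a s) = v $ s" if "s < ?m" for v s
    using that bij_betw_imp_inj_on[OF a] by (simp add: C_def inv_into_f_f)
  have surj_b: "\<exists>r<?k. p = b r" if "p \<in> P" for p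
    using bij_betw_imp_surj_on[OF b] that by (metis atLeastLessThan_iff imageE)
  have Av: "(A *\<^sub>v v) $ r = (\<Sum>i\<in>I. C v i * f i (b r))" if v: "v \<in> carrier_vec ?m" and r: "r < ?k" for v r
  proof -
    have "(A *\<^sub>v v) $ r = (\<Sum>s\<in>{0..<?m}. C v (a s) * f (a s) (b r))"
      using v r C by (simp add: A_def scalar_prod_def mult.commute)
    also have "\<dots> = (\<Sum>i\<in>I. C v i * f i (b r))"
      by (rule sum.reindex_bij_betw[OF a])
    finally show ?thesis .
  qed
  have inj: "inj_mat ?k ?m A"
    unfolding inj_mat_def
  proof (intro conjI Ac ballI impI)
    fix v assume v: "v \<in> carrier_vec ?m" and 0: "A *\<^sub>v v = 0\<^sub>v ?k"
    have "\<forall>p\<in>P. (\<Sum>i\<in>I. C v i * f i p) = 0"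
    proof
      fix p assume "p \<in> P"
      then obtain r where "r < ?k" "p = b r" using surj_b by blast
      then show "(\<Sum>i\<in>I. C v i * f i p) = 0" using Av[OF v, of r] 0 by simp
    qed
    from indep[OF this] have "C v i = 0" if "i \<in> I" for i using that .
    then have "v $ s = 0" if "s < ?m" for s using C[OF that, of v] bij_betwE[OF a] that by auto
    then show "v = 0\<^sub>v ?m" using v by (intro eq_vecI) auto
  qed
  show "?m \<le> ?k" by (rule inj_mat_dim_le[OF inj])
  assume eq: "?m = ?k"
  have "inj_mat ?k ?k A" using inj eq by simp
  then obtain B where B: "B \<in> carrier_mat ?k ?k" "A * B = 1\<^sub>m ?k"
    by (rule inj_mat_square_inverse)
  define w where "w = vec ?k (\<lambda>r. h (b r))"
  have w: "w \<in> carrier_vec ?k" by (simp add: w_def)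
  have Bw: "B *\<^sub>v w \<in> carrier_vec ?m" using B(1) w eq by simp
  have ABw: "A *\<^sub>v (B *\<^sub>v w) = w"
    using assoc_mult_mat_vec[of A ?k ?k B ?k w] Ac B w eq by simp
  have "\<forall>p\<in>P. (\<Sum>i\<in>I. C (B *\<^sub>v w) i * f i p) = h p"
  proof
    fix p assume "p \<in> P"
    then obtain r where r: "r < ?k" "p = b r" using surj_b by blast
    then show "(\<Sum>i\<in>I. C (B *\<^sub>v w) i * f i p) = h p" using Av[OF Bw r(1)] ABw by (simp add: w_def)
  qed
  then show "\<exists>c. \<forall>p\<in>P. (\<Sum>i\<in>I. c i * f i p) = h p" by blast
qed

section \<open>Traces\<close>

definition mat_trace :: "complex mat \<Rightarrow> complex" where
  "mat_trace A = (\<Sum>i<dim_row A. A $$ (i, i))"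

lemma mat_trace_comm:
  assumes "A \<in> carrier_mat n m" "B \<in> carrier_mat m n"
  shows "mat_trace (A * B) = mat_trace (B * A)"
proof -
  have "mat_trace (A * B) = (\<Sum>i<n. \<Sum>j<m. A $$ (i, j) * B $$ (j, i))"
    using assms by (auto simp: mat_trace_def scalar_prod_def atLeast0LessThan)
  also have "\<dots> = (\<Sum>j<m. \<Sum>i<n. B $$ (j, i) * A $$ (i, j))"
    by (subst sum.swap) (simp add: mult.commute)
  also have "\<dots> = mat_trace (B * A)"
    using assms by (auto simp: mat_trace_def scalar_prod_def atLeast0LessThan)
  finally show ?thesis .
qed

lemma triangularizable:
  fixes A :: "complex mat"
  assumes A: "A \<in> carrier_mat n n"
  obtains B P Q where "similar_mat_wit A B P Q" "upper_triangular B"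
    "B \<in> carrier_mat n n"
proof -
  from char_poly_factorized[OF A] obtain as where "char_poly A = (\<Prod>a\<leftarrow>as. [:- a, 1:])" by blast
  from schur_decomposition_exists[OF A this] that show thesis
    by (auto simp: similar_mat_def)
qed

lemma mat_trace_similar:
  assumes "similar_mat_wit A B P Q" "A \<in> carrier_mat n n"
  shows "mat_trace A = mat_trace B"
proof -
  note w = similar_mat_witD2[OF assms(2,1)]
  have "mat_trace A = mat_trace (P * (B * Q))" using w by (simp add: assoc_mult_mat[of _ n n _ n _ n])
  also have "\<dots> = mat_trace (B * Q * P)" using w by (intro mat_trace_comm[of _ n n]) auto
  also have "\<dots> = mat_trace B" using w by (simp add: assoc_mult_mat[of _ n n _ n _ n])
  finally show ?thesis .
qed

text \<open>The trace is the sum of the diagonal entries of a triangular form, and these are eigenvalues.\<close>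

lemma nonzero_trace_eigenvalue:
  assumes A: "A \<in> carrier_mat n n" and tr: "mat_trace A \<noteq> 0"
  obtains k where "eigenvalue A k" "k \<noteq> 0"
proof -
  obtain B P Q where sim: "similar_mat_wit A B P Q" and ut: "upper_triangular B" and B: "B \<in> carrier_mat n n"
    using triangularizable[OF A] .
  have "mat_trace B \<noteq> 0" using tr mat_trace_similar[OF sim A] by simp
  then obtain i where i: "i < n" "B $$ (i, i) \<noteq> 0"
    using B by (auto simp: mat_trace_def) (meson lessThan_iff sum.neutral)
  have "char_poly A = char_poly B" using sim by (intro char_poly_similar) (auto simp: similar_mat_def)
  also have "\<dots> = (\<Prod>a\<leftarrow>diag_mat B. [:- a, 1:])" by (rule char_poly_upper_triangular[OF B ut])
  finally have "poly (char_poly A) (B $$ (i, i)) = 0"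
    using i B by (auto simp: poly_prod_list diag_mat_def prod_list_zero_iff)
  then show thesis using that i eigenvalue_root_char_poly[OF A] by blast
qed

lemma upper_triangular_pow_diag:
  assumes B: "B \<in> carrier_mat n n" and ut: "upper_triangular (B :: complex mat)" 
  shows "upper_triangular (B ^\<^sub>m k) \<and> (\<forall>i<n. (B ^\<^sub>m k) $$ (i, i) = (B $$ (i, i)) ^ k)"
proof (induction k)
  case 0
  then show ?case using B by auto
next
  case (Suc k)
  let ?C = "B ^\<^sub>m k"
  have C: "?C \<in> carrier_mat n n" using B by (rule pow_carrier_mat)
  have entry: "(?C * B) $$ (i, j) = (\<Sum>l<n. ?C $$ (i, l) * B $$ (l, j))" if "i < n" "j < n" for i j
    using that B C by (auto simp: scalar_prod_def atLeast0LessThan)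
  have z: "?C $$ (i, l) * B $$ (l, j) = 0" if "i < n" "l < n" "l < i \<or> j < l" for i j l
    using that Suc ut B C by (auto simp: upper_triangular_def)
  have "(?C * B) $$ (i, j) = 0" if "i < n" "j < i" for i j
    using that by (subst entry) (auto intro!: sum.neutral z)
  moreover have "(?C * B) $$ (i, i) = B $$ (i, i) ^ Suc k" if "i < n" for i
  proof -
    have "(?C * B) $$ (i, i) = (\<Sum>l\<in>{i}. ?C $$ (i, l) * B $$ (l, i))"
      unfolding entry[OF that that]
    proof (intro sum.mono_neutral_right ballI)
      fix l assume "l \<in> {..<n} - {i}"
      then show "?C $$ (i, l) * B $$ (l, i) = 0" using that by (intro z) auto
    qed (use that in auto)
    then show ?thesis using Suc that by simp
  qed
  ultimately show ?case using B C by (auto simp: upper_triangular_def)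
qed

text \<open>The eigenvalues of a matrix of finite order are roots of unity, for which inversion is complex
  conjugation. The inverse is written here as the power \<open>A ^\<^sub>m k\<close>.\<close>

lemma trace_finite_order_inverse:
  assumes A: "A \<in> carrier_mat n n" and k: "A ^\<^sub>m Suc k = 1\<^sub>m n"
  shows "mat_trace (A ^\<^sub>m k) = cnj (mat_trace A)"
proof -
  obtain B P Q where sim: "similar_mat_wit A B P Q" and ut: "upper_triangular B" and B: "B \<in> carrier_mat n n"
    using triangularizable[OF A] .
  note w = similar_mat_witD2[OF A sim]
  have simk: "similar_mat_wit (A ^\<^sub>m m) (B ^\<^sub>m m) P Q" for m
    using similar_mat_wit_pow[OF sim] .
  have "B ^\<^sub>m Suc k = Q * 1\<^sub>m n * P"
    using similar_mat_witD2(3)[OF _ similar_mat_wit_sym[OF simk[of "Suc k"]], of n n] k B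
    by (metis pow_carrier_mat)
  then have "B ^\<^sub>m Suc k = 1\<^sub>m n" using w by simp
  then have d: "B $$ (i, i) ^ Suc k = 1" if "i < n" for i
    using upper_triangular_pow_diag[OF B ut, of "Suc k"] that by simp
  have d': "B $$ (i, i) ^ k = cnj (B $$ (i, i))" if "i < n" for i
  proof -
    have "cmod (B $$ (i, i)) = 1"
      using d[OF that] by (metis norm_one norm_power norm_ge_zero power_eq_1_iff zero_less_Suc nat.simps(3) power_eq_imp_eq_norm)
    then have "B $$ (i, i) * cnj (B $$ (i, i)) = 1" by (simp add: complex_norm_square[symmetric])
    with d[OF that] show ?thesis
      by (metis mult_cancel_left power_Suc zero_neq_one mult_eq_0_iff)
  qed
  have "mat_trace (A ^\<^sub>m k) = mat_trace (B ^\<^sub>m k)"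
    by (rule mat_trace_similar[OF simk]) (use A in auto)
  also have "\<dots> = (\<Sum>i<n. cnj (B $$ (i, i)))"
    using upper_triangular_pow_diag[OF B ut, of k] B by (simp add: mat_trace_def d')
  also have "\<dots> = cnj (mat_trace B)" using B by (simp add: mat_trace_def)
  also have "mat_trace B = mat_trace A" using mat_trace_similar[OF sim A] by simp
  finally show ?thesis .
qed

text \<open>Matrices of all sizes form one type, which therefore has no zero and no sum over sets; the size
  \<open>m \<times> n\<close> is given explicitly.\<close>

definition mat_sum :: "nat \<Rightarrow> nat \<Rightarrow> 'c set \<Rightarrow> ('c \<Rightarrow> complex mat) \<Rightarrow> complex mat" where
  "mat_sum m n A F = mat m n (\<lambda>ij. \<Sum>x\<in>A. F x $$ ij)"

lemma mat_sum_carrier [simp]: "mat_sum m n A F \<in> carrier_mat m n"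
  by (simp add: mat_sum_def)

lemma mat_sum_dims [simp]: "dim_row (mat_sum m n A F) = m" "dim_col (mat_sum m n A F) = n"
  by (simp_all add: mat_sum_def)

lemma mat_sum_index [simp]: "i < m \<Longrightarrow> j < n \<Longrightarrow> mat_sum m n A F $$ (i, j) = (\<Sum>x\<in>A. F x $$ (i, j))"
  by (simp add: mat_sum_def)

lemma mat_sum_cong: "(\<And>x. x \<in> A \<Longrightarrow> F x = F' x) \<Longrightarrow> mat_sum m n A F = mat_sum m n A F'"
  by (simp add: mat_sum_def)

lemma mat_sum_reindex:
  assumes "bij_betw \<phi> A B"
  shows "mat_sum m n A (\<lambda>x. F (\<phi> x)) = mat_sum m n B F"
  unfolding mat_sum_def by (intro cong_mat refl sum.reindex_bij_betw[OF assms])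

lemma mult_mat_sum:
  assumes "M \<in> carrier_mat k m" "\<And>x. x \<in> A \<Longrightarrow> F x \<in> carrier_mat m n"
  shows "M * mat_sum m n A F = mat_sum k n A (\<lambda>x. M * F x)"
proof (rule eq_matI)
  fix i j assume "i < dim_row (mat_sum k n A (\<lambda>x. M * F x))" "j < dim_col (mat_sum k n A (\<lambda>x. M * F x))"
  then have ij: "i < k" "j < n" by auto
  have "(M * mat_sum m n A F) $$ (i, j) = (\<Sum>l<m. \<Sum>x\<in>A. M $$ (i, l) * F x $$ (l, j))"
    using ij assms by (simp add: scalar_prod_def atLeast0LessThan sum_distrib_left)
  also have "\<dots> = (\<Sum>x\<in>A. (M * F x) $$ (i, j))"
    using ij assms by (subst sum.swap, intro sum.cong) (auto simp: scalar_prod_def atLeast0LessThan carrier_matD[OF assms(2)])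
  finally show "(M * mat_sum m n A F) $$ (i, j) = mat_sum k n A (\<lambda>x. M * F x) $$ (i, j)"
    using ij by simp
qed (use assms in auto)

lemma mat_sum_mult:
  assumes "M \<in> carrier_mat n k" "\<And>x. x \<in> A \<Longrightarrow> F x \<in> carrier_mat m n"
  shows "mat_sum m n A F * M = mat_sum m k A (\<lambda>x. F x * M)"
proof (rule eq_matI)
  fix i j assume "i < dim_row (mat_sum m k A (\<lambda>x. F x * M))" "j < dim_col (mat_sum m k A (\<lambda>x. F x * M))"
  then have ij: "i < m" "j < k" by auto
  have "(mat_sum m n A F * M) $$ (i, j) = (\<Sum>l<n. \<Sum>x\<in>A. F x $$ (i, l) * M $$ (l, j))"
    using ij assms by (simp add: scalar_prod_def atLeast0LessThan sum_distrib_right)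
  also have "\<dots> = (\<Sum>x\<in>A. (F x * M) $$ (i, j))"
    using ij assms by (subst sum.swap, intro sum.cong) (auto simp: scalar_prod_def atLeast0LessThan carrier_matD[OF assms(2)])
  finally show "(mat_sum m n A F * M) $$ (i, j) = mat_sum m k A (\<lambda>x. F x * M) $$ (i, j)"
    using ij by simp
qed (use assms in auto)

lemma mat_trace_sum:
  assumes "\<And>x. x \<in> A \<Longrightarrow> F x \<in> carrier_mat n n"
  shows "mat_trace (mat_sum n n A F) = (\<Sum>x\<in>A. mat_trace (F x))"
proof -
  have "mat_trace (mat_sum n n A F) = (\<Sum>i<n. \<Sum>x\<in>A. F x $$ (i, i))"
    by (simp add: mat_trace_def)
  also have "\<dots> = (\<Sum>x\<in>A. mat_trace (F x))"
    using assms by (subst sum.swap, intro sum.cong) (auto simp: mat_trace_def)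
  finally show ?thesis .
qed

lemma mat_trace_smult: "mat_trace (c \<cdot>\<^sub>m A) = c * mat_trace A" if "A \<in> carrier_mat n n"
  using that by (simp add: mat_trace_def sum_distrib_left)

lemma mat_trace_one: "mat_trace (1\<^sub>m n) = of_nat n"
  by (simp add: mat_trace_def)

section \<open>Partitions\<close>

lemma partition_on_sum:
  assumes P: "partition_on A P" and A: "finite A"
  shows "sum f A = (\<Sum>B\<in>P. sum f B)"
proof -
  have "sum f (\<Union>P) = (sum \<circ> sum) f P"
  proof (rule sum.Union_disjoint)
    show "\<forall>B\<in>P. finite B" using A finite_elements[OF A P] partition_onD1[OF P] by (auto intro: finite_subset)
    show "\<forall>B\<in>P. \<forall>C\<in>P. B \<noteq> C \<longrightarrow> B \<inter> C = {}"
      using partition_onD2[OF P] by (auto simp: disjoint_def)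
  qed
  then show ?thesis using partition_onD1[OF P] by simp
qed

lemma partition_on_block_eq:
  assumes "partition_on A P" "B \<in> P" "C \<in> P" "x \<in> B" "x \<in> C"
  shows "B = C"
  using partition_onD2[OF assms(1)] assms(2-) by (auto simp: disjoint_def)

lemma refinesI:
  assumes P: "partition_on A P" and Q: "partition_on A Q"
    and sub: "\<And>B C x y. B \<in> P \<Longrightarrow> C \<in> Q \<Longrightarrow> x \<in> B \<Longrightarrow> y \<in> B \<Longrightarrow> x \<in> C \<Longrightarrow> y \<in> C"
  shows "refines A P Q"
  unfolding refines_def
proof (intro conjI ballI P Q)
  fix B assume B: "B \<in> P"
  then obtain x where x: "x \<in> B" using partition_onD3[OF P] by (metis ex_in_conv)
  then obtain C where "C \<in> Q" "x \<in> C" using B partition_onD1[OF P] partition_onD1[OF Q] by auto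
  then show "\<exists>C\<in>Q. B \<subseteq> C" using sub[OF B _ x] by blast
qed

lemma partition_representatives:
  assumes P: "partition_on A P"
  obtains r where "\<And>B. B \<in> P \<Longrightarrow> r B \<in> B"
proof -
  have "\<forall>B\<in>P. \<exists>x. x \<in> B" using partition_onD3[OF P] by (metis ex_in_conv)
  then obtain r where "\<forall>B\<in>P. r B \<in> B" by metis
  then show thesis using that[of r] by blast
qed

lemma partition_sum_of_bool:
  fixes c :: "'c set \<Rightarrow> complex"
  assumes P: "partition_on A P" and A: "finite A" and B: "B \<in> P" "x \<in> B"
  shows "(\<Sum>C\<in>P. c C * of_bool (x \<in> C)) = c B"
proof -
  have "(\<Sum>C\<in>P. c C * of_bool (x \<in> C)) = (\<Sum>C\<in>P. if C = B then c C else 0)"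
  proof (rule sum.cong[OF refl])
    fix C assume "C \<in> P"
    then have "x \<in> C \<longleftrightarrow> C = B" using partition_on_block_eq[OF P \<open>C \<in> P\<close> B(1) _ B(2)] B(2) by blast
    then show "c C * of_bool (x \<in> C) = (if C = B then c C else 0)" by simp
  qed
  also have "\<dots> = c B" using finite_elements[OF A P] B(1) by simp
  finally show ?thesis .
qed

section \<open>Representations of a finite group\<close>

locale finite_group = group G for G (structure) +
  assumes fin: "finite (carrier G)"
begin

abbreviation ord_G :: complex where "ord_G \<equiv> of_nat (card (carrier G))"

lemma ord_G_nonzero: "ord_G \<noteq> 0"
  using fin by auto

lemma bij_mult_left: "h \<in> carrier G \<Longrightarrow> bij_betw (\<lambda>g. h \<otimes> g) (carrier G) (carrier G)"
  by (rule bij_betw_byWitness[where f' = "\<lambda>g. inv h \<otimes> g"]) (auto simp: m_assoc[symmetric])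

lemma bij_mult_right: "h \<in> carrier G \<Longrightarrow> bij_betw (\<lambda>g. g \<otimes> h) (carrier G) (carrier G)"
  by (rule bij_betw_byWitness[where f' = "\<lambda>g. g \<otimes> inv h"]) (auto simp: m_assoc)

lemma bij_conjugation: "h \<in> carrier G \<Longrightarrow> bij_betw (\<lambda>g. h \<otimes> g \<otimes> inv h) (carrier G) (carrier G)"
  using bij_betw_trans[OF bij_mult_left[of h] bij_mult_right[of "inv h"]] by (simp add: comp_def)

lemma is_rep_carrier: "is_rep G n \<rho> \<Longrightarrow> g \<in> carrier G \<Longrightarrow> \<rho> g \<in> carrier_mat n n"
  by (auto simp: is_rep_def hom_def units_of_def Units_def ring_mat_simps Pi_def)

lemma is_rep_mult:
  "is_rep G n \<rho> \<Longrightarrow> g \<in> carrier G \<Longrightarrow> h \<in> carrier G \<Longrightarrow> \<rho> (g \<otimes> h) = \<rho> g * \<rho> h"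
  by (auto simp: is_rep_def hom_def units_of_def ring_mat_simps)

lemma is_rep_one:
  assumes "is_rep G n \<rho>"
  shows "\<rho> \<one> = 1\<^sub>m n"
proof -
  interpret R: ring "ring_mat TYPE(complex) n ()" by (rule ring_mat)
  interpret group_hom G "units_of (ring_mat TYPE(complex) n ())" \<rho>
    using assms R.units_group unfolding is_rep_def
    by (intro group_hom.intro group_hom_axioms.intro is_group) auto
  show ?thesis using hom_one by (simp add: units_of_def ring_mat_simps)
qed

lemma is_rep_inv:
  assumes "is_rep G n \<rho>" "g \<in> carrier G"
  shows "\<rho> g * \<rho> (inv g) = 1\<^sub>m n" "\<rho> (inv g) * \<rho> g = 1\<^sub>m n"
  using is_rep_mult[OF assms(1), of g "inv g"] is_rep_mult[OF assms(1), of "inv g" g] assms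
  by (simp_all add: is_rep_one)

lemma is_repI:
  assumes "\<And>g. g \<in> carrier G \<Longrightarrow> \<rho> g \<in> carrier_mat n n"
    and "\<And>g h. g \<in> carrier G \<Longrightarrow> h \<in> carrier G \<Longrightarrow> \<rho> (g \<otimes> h) = \<rho> g * \<rho> h"
    and "\<rho> \<one> = 1\<^sub>m n"
  shows "is_rep G n \<rho>"
proof -
  have "\<rho> g \<in> Units (ring_mat TYPE(complex) n ())" if g: "g \<in> carrier G" for g
    using assms(1)[OF g] assms(1)[of "inv g"] assms(2)[of g "inv g"] assms(2)[of "inv g" g] assms(3) g
    by (auto simp: Units_def ring_mat_simps intro!: bexI[of _ "\<rho> (inv g)"])
  then show ?thesis using assms(2)
    by (auto simp: is_rep_def hom_def units_of_def ring_mat_simps)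
qed

lemma is_rep_pow:
  assumes "is_rep G n \<rho>" "g \<in> carrier G"
  shows "\<rho> (g [^] k) = \<rho> g ^\<^sub>m k"
proof (induction k)
  case 0
  then show ?case using assms is_rep_carrier[OF assms] by (simp add: is_rep_one)
next
  case (Suc k)
  then show ?case using assms by (simp add: is_rep_mult[OF assms(1)])
qed

lemma irreducible_rep_is_rep: "irreducible_rep G n \<rho> \<Longrightarrow> is_rep G n \<rho>"
  and irreducible_rep_degree_pos: "irreducible_rep G n \<rho> \<Longrightarrow> n > 0"
  by (auto simp: irreducible_rep_def)

lemma irreducible_rep_subspace:
  assumes "irreducible_rep G n \<rho>" "vec_subspace n W"
    "\<And>g w. g \<in> carrier G \<Longrightarrow> w \<in> W \<Longrightarrow> \<rho> g *\<^sub>v w \<in> W"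
  shows "W = {0\<^sub>v n} \<or> W = carrier_vec n"
  using assms by (auto simp: irreducible_rep_def invariant_subspace_def vec_subspace_iff)

lemma rep_character_trace: "g \<in> carrier G \<Longrightarrow> rep_character G \<rho> g = mat_trace (\<rho> g)"
  by (simp add: rep_character_def mat_trace_def)

section \<open>Schur's lemma\<close>

text \<open>The kernel and the range of an intertwining matrix are invariant, so \<open>T \<noteq> 0\<close> must be bijective. Then
  \<open>T\<close> is invertible, conjugation by it carries one representation to the other, and the traces agree.\<close>

lemma schur_distinct:
  assumes \<rho>: "irreducible_rep G n \<rho>" and \<sigma>: "irreducible_rep G m \<sigma>"
    and T: "T \<in> carrier_mat m n"
    and comm: "\<And>g. g \<in> carrier G \<Longrightarrow> \<sigma> g * T = T * \<rho> g"
    and nz: "T \<noteq> 0\<^sub>m m n"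
  shows "rep_character G \<sigma> = rep_character G \<rho>"
proof -
  note r = irreducible_rep_is_rep[OF \<rho>] and s = irreducible_rep_is_rep[OF \<sigma>]
  have commv: "\<sigma> g *\<^sub>v (T *\<^sub>v v) = T *\<^sub>v (\<rho> g *\<^sub>v v)" if "g \<in> carrier G" "v \<in> carrier_vec n" for g v
    using comm[OF that(1)] T is_rep_carrier[OF r that(1)] is_rep_carrier[OF s that(1)] that(2)
    by (metis assoc_mult_mat_vec)
  have nz': "\<not> (\<forall>v\<in>carrier_vec n. T *\<^sub>v v = 0\<^sub>v m)"
  proof
    assume "\<forall>v\<in>carrier_vec n. T *\<^sub>v v = 0\<^sub>v m"
    then have "T = 0\<^sub>m m n"
      using T by (intro mat_eq_if_mult_vec_eq[of T m n]) auto
    with nz show False ..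
  qed
  define K where "K = {v \<in> carrier_vec n. T *\<^sub>v v = 0\<^sub>v m}"
  have "K = {0\<^sub>v n} \<or> K = carrier_vec n"
  proof (rule irreducible_rep_subspace[OF \<rho>])
    show "vec_subspace n K" unfolding vec_subspace_def K_def
      using T by (auto simp: mult_add_distrib_mat_vec[of T m n] mult_mat_vec[of T m n])
    fix g w assume g: "g \<in> carrier G" and w: "w \<in> K"
    have sg: "\<sigma> g \<in> carrier_mat m m" and rg: "\<rho> g \<in> carrier_mat n n"
      using is_rep_carrier r s g by auto
    have wc: "w \<in> carrier_vec n" and Tw: "T *\<^sub>v w = 0\<^sub>v m" using w by (auto simp: K_def)
    have "T *\<^sub>v (\<rho> g *\<^sub>v w) = \<sigma> g *\<^sub>v 0\<^sub>v m" using commv[OF g wc] Tw by simp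
    also have "\<dots> = 0\<^sub>v m" using sg by auto
    finally show "\<rho> g *\<^sub>v w \<in> K" using wc rg by (auto simp: K_def)
  qed
  then have K: "K = {0\<^sub>v n}" using nz' by (auto simp: K_def)
  then have injT: "inj_mat m n T" using T by (auto simp: inj_mat_def K_def)
  define R where "R = {T *\<^sub>v v | v. v \<in> carrier_vec n}"
  have "R = {0\<^sub>v m} \<or> R = carrier_vec m"
  proof (rule irreducible_rep_subspace[OF \<sigma>])
    show "vec_subspace m R" unfolding vec_subspace_def
    proof (intro conjI ballI allI)
      show "R \<subseteq> carrier_vec m" using T by (auto simp: R_def)
      show "0\<^sub>v m \<in> R" unfolding R_def using T by (auto intro!: exI[of _ "0\<^sub>v n"])
      fix v w assume "v \<in> R" "w \<in> R"
      then show "v + w \<in> R" unfolding R_def using T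
        by (auto simp: mult_add_distrib_mat_vec[of T m n, symmetric])
    next
      fix c w assume "w \<in> R"
      then show "c \<cdot>\<^sub>v w \<in> R" unfolding R_def using T
        by (auto simp: mult_mat_vec[of T m n, symmetric])
    qed
    fix g w assume g: "g \<in> carrier G" and w: "w \<in> R"
    then show "\<sigma> g *\<^sub>v w \<in> R" using commv[OF g] is_rep_carrier[OF r g] by (auto simp: R_def)
  qed
  then have R: "R = carrier_vec m" using nz' by (auto simp: R_def)
  have "\<exists>v\<in>carrier_vec n. T *\<^sub>v v = col (1\<^sub>m m) j" if "j < m" for j
  proof -
    have "col (1\<^sub>m m) j \<in> R" unfolding R using that by (simp add: carrier_vecI)
    then show ?thesis by (auto simp: R_def)
  qed
  \<comment> \<open>A right inverse of \<open>T\<close> is injective, which bounds \<open>m\<close> by \<open>n\<close>; the kernel of \<open>T\<close> gives the other bound.\<close>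
  then obtain S where S: "S \<in> carrier_mat n m" "1\<^sub>m m = T * S"
    using factor_through_columns[OF T, of "1\<^sub>m m" m] by auto
  have "v = 0\<^sub>v m" if v: "v \<in> carrier_vec m" "S *\<^sub>v v = 0\<^sub>v n" for v
  proof -
    have "v = (T * S) *\<^sub>v v" using S(2)[symmetric] v(1) by simp
    also have "\<dots> = T *\<^sub>v (S *\<^sub>v v)" using T S(1) v(1) by simp
    also have "\<dots> = 0\<^sub>v m" using T v(2) by auto
    finally show ?thesis .
  qed
  then have "inj_mat n m S" using S by (auto simp: inj_mat_def)
  then have mn: "m = n" using inj_mat_dim_le injT by (meson antisym)
  obtain U where U: "U \<in> carrier_mat n n" "T * U = 1\<^sub>m n" "U * T = 1\<^sub>m n"
    using inj_mat_square_inverse injT mn by blast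
  show ?thesis
  proof
    fix g show "rep_character G \<sigma> g = rep_character G \<rho> g"
    proof (cases "g \<in> carrier G")
      case True
      have rg: "\<rho> g \<in> carrier_mat n n" and sg: "\<sigma> g \<in> carrier_mat n n" and Tn: "T \<in> carrier_mat n n"
        using is_rep_carrier[OF r True] is_rep_carrier[OF s True] mn T by auto
      have "mat_trace (\<sigma> g) = mat_trace (\<sigma> g * (T * U))" using U sg by simp
      also have "\<dots> = mat_trace (T * \<rho> g * U)"
        using comm[OF True] sg Tn U(1) by (simp flip: assoc_mult_mat[of _ n n _ n _ n])
      also have "\<dots> = mat_trace (U * (T * \<rho> g))"
        using rg Tn U(1) by (intro mat_trace_comm[of _ n n]) auto
      also have "\<dots> = mat_trace (\<rho> g)"
        using rg Tn U(1,3) by (simp flip: assoc_mult_mat[of _ n n _ n _ n])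
      finally show ?thesis using True by (simp add: rep_character_trace)
    qed (simp add: rep_character_def)
  qed
qed

text \<open>An eigenspace of \<open>T\<close> is invariant and not zero, hence everything.\<close>

lemma schur_scalar:
  assumes \<rho>: "irreducible_rep G n \<rho>"
    and T: "T \<in> carrier_mat n n"
    and comm: "\<And>g. g \<in> carrier G \<Longrightarrow> \<rho> g * T = T * \<rho> g"
  shows "\<exists>c. T = c \<cdot>\<^sub>m 1\<^sub>m n"
proof -
  note r = irreducible_rep_is_rep[OF \<rho>]
  obtain as where as: "char_poly T = (\<Prod>a\<leftarrow>as. [:- a, 1:])" "length as = n"
    using char_poly_factorized[OF T] by blast
  then obtain c where c: "c \<in> set as"
    using irreducible_rep_degree_pos[OF \<rho>] by (metis length_0_conv neq_Nil_conv list.set_intros(1) less_irrefl)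
  have "poly (char_poly T) c = 0" using c by (auto simp: as(1) poly_prod_list prod_list_zero_iff)
  then have "eigenvalue T c" using eigenvalue_root_char_poly[OF T] by simp
  then obtain v where v: "v \<in> carrier_vec n" "v \<noteq> 0\<^sub>v n" "T *\<^sub>v v = c \<cdot>\<^sub>v v"
    using T by (auto simp: eigenvalue_def eigenvector_def)
  define W where "W = {v \<in> carrier_vec n. T *\<^sub>v v = c \<cdot>\<^sub>v v}"
  have "W = {0\<^sub>v n} \<or> W = carrier_vec n"
  proof (rule irreducible_rep_subspace[OF \<rho>])
    show "vec_subspace n W" unfolding vec_subspace_def W_def
      using T by (auto simp: mult_add_distrib_mat_vec[of T n n] mult_mat_vec[of T n n]
          smult_add_distrib_vec[of _ n] smult_smult_assoc mult.commute)
    fix g w assume g: "g \<in> carrier G" and w: "w \<in> W"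
    have rg: "\<rho> g \<in> carrier_mat n n" by (rule is_rep_carrier[OF r g])
    have wc: "w \<in> carrier_vec n" and Tw: "T *\<^sub>v w = c \<cdot>\<^sub>v w" using w by (auto simp: W_def)
    have "T *\<^sub>v (\<rho> g *\<^sub>v w) = \<rho> g *\<^sub>v (T *\<^sub>v w)"
      using comm[OF g] T rg wc by (metis assoc_mult_mat_vec)
    also have "\<dots> = c \<cdot>\<^sub>v (\<rho> g *\<^sub>v w)" using Tw rg wc by (simp add: mult_mat_vec)
    finally show "\<rho> g *\<^sub>v w \<in> W" using rg wc by (auto simp: W_def)
  qed
  then have "W = carrier_vec n" using v by (auto simp: W_def)
  have "T *\<^sub>v w = (c \<cdot>\<^sub>m 1\<^sub>m n) *\<^sub>v w" if "w \<in> carrier_vec n" for w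
  proof -
    have "(c \<cdot>\<^sub>m 1\<^sub>m n) *\<^sub>v w = c \<cdot>\<^sub>v w"
      using that by (intro eq_vecI) (auto simp: row_smult[of _ "1\<^sub>m n"])
    then show ?thesis using that \<open>W = carrier_vec n\<close> by (auto simp: W_def)
  qed
  then have "T = c \<cdot>\<^sub>m 1\<^sub>m n" using T by (intro mat_eq_if_mult_vec_eq[of T n n]) auto
  then show ?thesis ..
qed

section \<open>Orthogonality of irreducible characters\<close>

text \<open>Every matrix \<open>E\<close> averages in this way to a matrix that intertwines the two representations.\<close>

definition average where
  "average m n \<sigma> E \<rho> = mat_sum m n (carrier G) (\<lambda>g. \<sigma> g * E * \<rho> (inv g))"

lemma average_intertwines:
  assumes r: "is_rep G n \<rho>" and s: "is_rep G m \<sigma>" and E: "E \<in> carrier_mat m n" and h: "h \<in> carrier G"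
  shows "\<sigma> h * average m n \<sigma> E \<rho> = average m n \<sigma> E \<rho> * \<rho> h"
proof -
  have rc: "\<rho> g \<in> carrier_mat n n" and sc: "\<sigma> g \<in> carrier_mat m m" if "g \<in> carrier G" for g
    using is_rep_carrier r s that by auto
  have cE: "\<sigma> g * E * \<rho> (inv g) \<in> carrier_mat m n" if "g \<in> carrier G" for g
    using rc[of "inv g"] sc[of g] E that by (intro mult_carrier_mat) auto
  have "average m n \<sigma> E \<rho> * \<rho> h = mat_sum m n (carrier G) (\<lambda>g. \<sigma> g * E * \<rho> (inv g) * \<rho> h)"
    unfolding average_def by (rule mat_sum_mult) (use rc sc h cE in auto)
  also have "\<dots> = mat_sum m n (carrier G) (\<lambda>g. \<sigma> (h \<otimes> g) * E * \<rho> (inv (h \<otimes> g)) * \<rho> h)"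
    by (rule mat_sum_reindex[OF bij_mult_left[OF h], symmetric])
  also have "\<dots> = mat_sum m n (carrier G) (\<lambda>g. \<sigma> h * (\<sigma> g * E * \<rho> (inv g)))"
  proof (rule mat_sum_cong)
    fix g assume g: "g \<in> carrier G"
    have "\<rho> (inv (h \<otimes> g)) * \<rho> h = \<rho> (inv (h \<otimes> g) \<otimes> h)" using g h by (simp add: is_rep_mult[OF r])
    also have "inv (h \<otimes> g) \<otimes> h = inv g" using g h by (simp add: inv_mult_group m_assoc)
    finally have "\<rho> (inv (h \<otimes> g)) * \<rho> h = \<rho> (inv g)" .
    moreover have "\<sigma> (h \<otimes> g) * E * \<rho> (inv (h \<otimes> g)) * \<rho> h = \<sigma> (h \<otimes> g) * E * (\<rho> (inv (h \<otimes> g)) * \<rho> h)"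
      using g h E by (intro assoc_mult_mat[of _ m n _ n _ n] mult_carrier_mat[of _ m m] rc sc) auto
    ultimately have "\<sigma> (h \<otimes> g) * E * \<rho> (inv (h \<otimes> g)) * \<rho> h = \<sigma> h * \<sigma> g * E * \<rho> (inv g)"
      using g h by (simp add: is_rep_mult[OF s])
    also have "\<dots> = \<sigma> h * (\<sigma> g * E * \<rho> (inv g))"
      using rc[of "inv g"] sc[OF g] sc[OF h] g E
      by (simp add: assoc_mult_mat[of _ m m _ m _ n] assoc_mult_mat[of _ m m _ n _ n])
    finally show "\<sigma> (h \<otimes> g) * E * \<rho> (inv (h \<otimes> g)) * \<rho> h = \<sigma> h * (\<sigma> g * E * \<rho> (inv g))" .
  qed
  also have "\<dots> = \<sigma> h * average m n \<sigma> E \<rho>"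
    unfolding average_def by (rule mult_mat_sum[symmetric]) (use rc sc h cE in auto)
  finally show ?thesis ..
qed

definition elem_mat :: "nat \<Rightarrow> nat \<Rightarrow> nat \<Rightarrow> nat \<Rightarrow> complex mat" where
  "elem_mat m n i k = mat m n (\<lambda>ab. if ab = (i, k) then 1 else 0)"

lemma average_elem_mat_entry:
  assumes r: "is_rep G n \<rho>" and s: "is_rep G m \<sigma>" and ik: "i < m" "k < n"
  shows "average m n \<sigma> (elem_mat m n i k) \<rho> $$ (i, k) = (\<Sum>g\<in>carrier G. \<sigma> g $$ (i, i) * \<rho> (inv g) $$ (k, k))"
proof -
  have "(\<sigma> g * elem_mat m n i k * \<rho> (inv g)) $$ (i, k) = \<sigma> g $$ (i, i) * \<rho> (inv g) $$ (k, k)"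
    if g: "g \<in> carrier G" for g
  proof -
    have rc: "\<rho> (inv g) \<in> carrier_mat n n" and sc: "\<sigma> g \<in> carrier_mat m m"
      using is_rep_carrier r s g by auto
    have "(\<sigma> g * elem_mat m n i k) $$ (i, b) = (if b = k then \<sigma> g $$ (i, i) else 0)" if "b < n" for b
      using that ik sc by (auto simp: elem_mat_def scalar_prod_def if_distrib[of "\<lambda>x. _ * x"] cong: if_cong)
    then show ?thesis
      using ik rc sc by (auto simp: elem_mat_def scalar_prod_def if_distrib[of "\<lambda>x. x * _"] cong: if_cong)
  qed
  then show ?thesis using ik by (simp add: average_def)
qed

text \<open>The diagonal entries that occur in the product of two characters are entries of averaged matrix units.
  In this form Schur's lemma evaluates the sum.\<close>

lemma character_sum_expand:
  assumes r: "is_rep G n \<rho>" and s: "is_rep G m \<sigma>"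
  shows "(\<Sum>g\<in>carrier G. rep_character G \<sigma> g * rep_character G \<rho> (inv g)) =
    (\<Sum>i<m. \<Sum>k<n. average m n \<sigma> (elem_mat m n i k) \<rho> $$ (i, k))"
proof -
  have "(\<Sum>g\<in>carrier G. rep_character G \<sigma> g * rep_character G \<rho> (inv g)) =
    (\<Sum>g\<in>carrier G. \<Sum>i<m. \<Sum>k<n. \<sigma> g $$ (i, i) * \<rho> (inv g) $$ (k, k))"
  proof (rule sum.cong[OF refl])
    fix g assume g: "g \<in> carrier G"
    then have "dim_row (\<sigma> g) = m" "dim_row (\<rho> (inv g)) = n"
      using is_rep_carrier[OF r, of "inv g"] is_rep_carrier[OF s g] by auto
    then show "rep_character G \<sigma> g * rep_character G \<rho> (inv g) =
      (\<Sum>i<m. \<Sum>k<n. \<sigma> g $$ (i, i) * \<rho> (inv g) $$ (k, k))"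
      using g by (simp add: rep_character_trace mat_trace_def sum_product)
  qed
  also have "\<dots> = (\<Sum>i<m. \<Sum>k<n. \<Sum>g\<in>carrier G. \<sigma> g $$ (i, i) * \<rho> (inv g) $$ (k, k))"
    by (subst sum.swap, rule sum.cong[OF refl], rule sum.swap)
  also have "\<dots> = (\<Sum>i<m. \<Sum>k<n. average m n \<sigma> (elem_mat m n i k) \<rho> $$ (i, k))"
    by (intro sum.cong refl) (simp add: average_elem_mat_entry[OF r s])
  finally show ?thesis .
qed

lemma orthogonality_distinct:
  assumes \<rho>: "irreducible_rep G n \<rho>" and \<sigma>: "irreducible_rep G m \<sigma>"
    and ne: "rep_character G \<sigma> \<noteq> rep_character G \<rho>"
  shows "(\<Sum>g\<in>carrier G. rep_character G \<sigma> g * rep_character G \<rho> (inv g)) = 0"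
proof -
  note r = irreducible_rep_is_rep[OF \<rho>] and s = irreducible_rep_is_rep[OF \<sigma>]
  have "average m n \<sigma> (elem_mat m n i k) \<rho> = 0\<^sub>m m n" for i k
  proof (rule ccontr)
    assume "average m n \<sigma> (elem_mat m n i k) \<rho> \<noteq> 0\<^sub>m m n"
    then have "rep_character G \<sigma> = rep_character G \<rho>"
      using schur_distinct[OF \<rho> \<sigma> _ average_intertwines[OF r s]]
      by (metis average_def elem_mat_def mat_carrier mat_sum_carrier)
    with ne show False ..
  qed
  then show ?thesis by (simp add: character_sum_expand[OF r s])
qed

lemma orthogonality_same:
  assumes \<rho>: "irreducible_rep G n \<rho>"
  shows "(\<Sum>g\<in>carrier G. rep_character G \<rho> g * rep_character G \<rho> (inv g)) = ord_G"
proof -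
  note r = irreducible_rep_is_rep[OF \<rho>]
  have n: "n > 0" by (rule irreducible_rep_degree_pos[OF \<rho>])
  have "average n n \<rho> (elem_mat n n i k) \<rho> $$ (i, k) = (if i = k then ord_G / of_nat n else 0)"
    if ik: "i < n" "k < n" for i k
  proof -
    let ?E = "elem_mat n n i k"
    have E: "?E \<in> carrier_mat n n" by (simp add: elem_mat_def)
    obtain c where c: "average n n \<rho> ?E \<rho> = c \<cdot>\<^sub>m 1\<^sub>m n"
      using schur_scalar[OF \<rho>, of "average n n \<rho> ?E \<rho>"] average_intertwines[OF r r E]
      by (auto simp: average_def)
    have tr: "mat_trace ?E = (if i = k then 1 else 0)"
      using ik by (auto simp: mat_trace_def elem_mat_def)
    have "c * of_nat n = mat_trace (average n n \<rho> ?E \<rho>)"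
      by (simp add: c mat_trace_smult[of _ n] mat_trace_one)
    also have "\<dots> = (\<Sum>g\<in>carrier G. mat_trace (\<rho> g * ?E * \<rho> (inv g)))"
      unfolding average_def
      by (rule mat_trace_sum, intro mult_carrier_mat) (use E is_rep_carrier[OF r] in auto)
    also have "\<dots> = (\<Sum>g\<in>carrier G. mat_trace ?E)"
    proof (rule sum.cong[OF refl])
      fix g assume g: "g \<in> carrier G"
      have rg: "\<rho> g \<in> carrier_mat n n" and ri: "\<rho> (inv g) \<in> carrier_mat n n"
        using is_rep_carrier[OF r] g by auto
      have "mat_trace (\<rho> g * ?E * \<rho> (inv g)) = mat_trace (\<rho> (inv g) * (\<rho> g * ?E))"
        using rg ri E by (intro mat_trace_comm[of _ n n]) auto
      also have "\<rho> (inv g) * (\<rho> g * ?E) = ?E"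
        using rg ri E is_rep_inv(2)[OF r g] by (simp flip: assoc_mult_mat[of _ n n _ n _ n])
      finally show "mat_trace (\<rho> g * ?E * \<rho> (inv g)) = mat_trace ?E" .
    qed
    finally have "c * of_nat n = ord_G * (if i = k then 1 else 0)" by (simp add: tr)
    then show ?thesis using n ik by (auto simp: c field_simps)
  qed
  then show ?thesis using n by (simp add: character_sum_expand[OF r r])
qed

lemma orthogonality:
  assumes "\<chi> \<in> Irr G" "\<psi> \<in> Irr G"
  shows "(\<Sum>g\<in>carrier G. \<chi> g * \<psi> (inv g)) = (if \<chi> = \<psi> then ord_G else 0)"
  using assms orthogonality_distinct orthogonality_same by (auto simp: Irr_def)

section \<open>Values of irreducible characters\<close>

text \<open>The powers of \<open>g\<close> cannot all be distinct in a finite group. The exponent is kept in the form \<open>Suc k\<close> so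
  that \<open>g [^] k\<close> is the inverse of \<open>g\<close>.\<close>

lemma power_eq_one:
  assumes g: "g \<in> carrier G"
  obtains k where "g [^] Suc k = \<one>"
proof -
  have "range (\<lambda>k::nat. g [^] k) \<subseteq> carrier G" using g by auto
  then have "\<not> inj (\<lambda>k::nat. g [^] k)"
    using fin finite_subset finite_imageD infinite_UNIV_nat by metis
  then obtain i j :: nat where "i < j" "g [^] i = g [^] j"
    unfolding inj_def by (metis linorder_neqE_nat)
  moreover from \<open>i < j\<close> obtain k where "j = i + Suc k" by (metis less_imp_Suc_add add_Suc_right)
  ultimately have "g [^] i \<otimes> g [^] Suc k = g [^] i \<otimes> \<one>"
    using g by (metis nat_pow_mult nat_pow_closed r_one)
  then show thesis using g that[of k] by (simp add: Units_l_cancel[unfolded Units_eq])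
qed

text \<open>This is where the definition of \<open>ClPt\<close> through \<open>\<sigma>\<^sub>X\<close> itself meets the Fourier transform, which produces
  \<open>\<sigma>\<^sub>X\<close> at inverse elements: both functions separate the same elements.\<close>

lemma Irr_inv: 
  assumes "\<chi> \<in> Irr G" "g \<in> carrier G"
  shows "\<chi> (inv g) = cnj (\<chi> g)"
proof -
  obtain n \<rho> where \<rho>: "irreducible_rep G n \<rho>" "\<chi> = rep_character G \<rho>"
    using assms(1) by (auto simp: Irr_def)
  note r = irreducible_rep_is_rep[OF \<rho>(1)]
  obtain k where gk: "g [^] Suc k = \<one>" using power_eq_one[OF assms(2)] .
  then have "inv g = g [^] k" using assms(2) by (intro inv_equality) auto
  then have "\<rho> (inv g) = \<rho> g ^\<^sub>m k" using is_rep_pow[OF r assms(2)] by simp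
  moreover have "\<rho> g ^\<^sub>m Suc k = 1\<^sub>m n"
    using is_rep_pow[OF r assms(2), of "Suc k"] gk is_rep_one[OF r] by simp
  ultimately show ?thesis
    using trace_finite_order_inverse[OF is_rep_carrier[OF r assms(2)], of k] assms(2)
    by (simp add: \<rho>(2) rep_character_trace)
qed

lemma Irr_one_nonzero:
  assumes "\<chi> \<in> Irr G"
  shows "\<chi> \<one> \<noteq> 0"
proof -
  obtain n \<rho> where \<rho>: "irreducible_rep G n \<rho>" "\<chi> = rep_character G \<rho>"
    using assms by (auto simp: Irr_def)
  have "\<chi> \<one> = of_nat n"
    using is_rep_one[OF irreducible_rep_is_rep[OF \<rho>(1)]]
    by (simp add: \<rho>(2) rep_character_trace mat_trace_one)
  then show ?thesis using irreducible_rep_degree_pos[OF \<rho>(1)] by simp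
qed

lemma Irr_one_real: "\<chi> \<in> Irr G \<Longrightarrow> cnj (\<chi> \<one>) = \<chi> \<one>"
  using Irr_inv[OF _ one_closed] unfolding inv_one by (rule sym)

section \<open>Class functions acting in a representation\<close>


definition class_function :: "('a \<Rightarrow> complex) \<Rightarrow> bool" where
  "class_function f \<longleftrightarrow> (\<forall>g\<in>carrier G. \<forall>h\<in>carrier G. f (h \<otimes> g \<otimes> inv h) = f g)"

lemma class_functionD:
  "class_function f \<Longrightarrow> g \<in> carrier G \<Longrightarrow> h \<in> carrier G \<Longrightarrow> f (h \<otimes> g \<otimes> inv h) = f g"
  by (simp add: class_function_def)

text \<open>The action of the group algebra element \<open>\<Sum>g. f g g\<close> in the representation \<open>\<rho>\<close>.\<close>

definition rep_sum :: "nat \<Rightarrow> ('a \<Rightarrow> complex mat) \<Rightarrow> ('a \<Rightarrow> complex) \<Rightarrow> complex mat" where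
  "rep_sum n \<rho> f = mat_sum n n (carrier G) (\<lambda>g. f g \<cdot>\<^sub>m \<rho> g)"

lemma rep_sum_carrier [simp]: "rep_sum n \<rho> f \<in> carrier_mat n n"
  by (simp add: rep_sum_def)

lemma mat_trace_rep_sum:
  assumes r: "is_rep G n \<rho>"
  shows "mat_trace (rep_sum n \<rho> f) = (\<Sum>g\<in>carrier G. f g * rep_character G \<rho> g)"
proof -
  have "mat_trace (rep_sum n \<rho> f) = (\<Sum>g\<in>carrier G. mat_trace (f g \<cdot>\<^sub>m \<rho> g))"
    unfolding rep_sum_def by (rule mat_trace_sum) (use is_rep_carrier[OF r] in auto)
  also have "\<dots> = (\<Sum>g\<in>carrier G. f g * rep_character G \<rho> g)"
    by (intro sum.cong refl) (simp add: rep_character_trace mat_trace_smult[OF is_rep_carrier[OF r]])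
  finally show ?thesis .
qed

text \<open>Class functions are the central elements of the group algebra.\<close>

lemma rep_sum_commutes:
  assumes r: "is_rep G n \<rho>" and f: "class_function f" and h: "h \<in> carrier G"
  shows "\<rho> h * rep_sum n \<rho> f = rep_sum n \<rho> f * \<rho> h"
proof -
  note rc = is_rep_carrier[OF r]
  have "rep_sum n \<rho> f * \<rho> h = mat_sum n n (carrier G) (\<lambda>g. f g \<cdot>\<^sub>m \<rho> g * \<rho> h)"
    unfolding rep_sum_def by (rule mat_sum_mult) (use rc h in auto)
  also have "\<dots> = mat_sum n n (carrier G) (\<lambda>g. f (h \<otimes> g \<otimes> inv h) \<cdot>\<^sub>m \<rho> (h \<otimes> g \<otimes> inv h) * \<rho> h)"
    by (rule mat_sum_reindex[OF bij_conjugation[OF h], symmetric])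
  also have "\<dots> = mat_sum n n (carrier G) (\<lambda>g. \<rho> h * (f g \<cdot>\<^sub>m \<rho> g))"
  proof (rule mat_sum_cong)
    fix g assume g: "g \<in> carrier G"
    have "\<rho> (h \<otimes> g \<otimes> inv h) * \<rho> h = \<rho> (h \<otimes> g \<otimes> inv h \<otimes> h)"
      using g h by (simp add: is_rep_mult[OF r])
    also have "h \<otimes> g \<otimes> inv h \<otimes> h = h \<otimes> g" using g h by (simp add: m_assoc)
    finally have "\<rho> (h \<otimes> g \<otimes> inv h) * \<rho> h = \<rho> h * \<rho> g" using g h by (simp add: is_rep_mult[OF r])
    then show "f (h \<otimes> g \<otimes> inv h) \<cdot>\<^sub>m \<rho> (h \<otimes> g \<otimes> inv h) * \<rho> h = \<rho> h * (f g \<cdot>\<^sub>m \<rho> g)"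
      using g h rc[OF g] rc[OF h] rc[of "h \<otimes> g \<otimes> inv h"]
      by (simp add: class_functionD[OF f] mult_smult_assoc_mat[of _ n n _ n] mult_smult_distrib[of _ n n _ n])
  qed
  also have "\<dots> = \<rho> h * rep_sum n \<rho> f"
    unfolding rep_sum_def by (rule mult_mat_sum[symmetric]) (use rc h in auto)
  finally show ?thesis ..
qed

lemma rep_sum_intertwines:
  assumes r: "is_rep G n \<rho>" and s: "is_rep G d \<sigma>" and P: "P \<in> carrier_mat n d"
    and comm: "\<And>g. g \<in> carrier G \<Longrightarrow> \<rho> g * P = P * \<sigma> g"
  shows "rep_sum n \<rho> f * P = P * rep_sum d \<sigma> f"
proof -
  note rc = is_rep_carrier[OF r] and sc = is_rep_carrier[OF s]
  have "rep_sum n \<rho> f * P = mat_sum n d (carrier G) (\<lambda>g. f g \<cdot>\<^sub>m \<rho> g * P)"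
    unfolding rep_sum_def by (rule mat_sum_mult) (use rc P in auto)
  also have "\<dots> = mat_sum n d (carrier G) (\<lambda>g. P * (f g \<cdot>\<^sub>m \<sigma> g))"
  proof (rule mat_sum_cong)
    fix g assume g: "g \<in> carrier G"
    show "f g \<cdot>\<^sub>m \<rho> g * P = P * (f g \<cdot>\<^sub>m \<sigma> g)"
      using rc[OF g] sc[OF g] P comm[OF g]
      by (simp add: mult_smult_assoc_mat[of _ n n _ d] mult_smult_distrib[of _ n d _ d])
  qed
  also have "\<dots> = P * rep_sum d \<sigma> f"
    unfolding rep_sum_def by (rule mult_mat_sum[symmetric]) (use sc P in auto)
  finally show ?thesis .
qed

text \<open>By Schur's lemma the matrix is a scalar, and the hypothesis says that its trace is zero.\<close>

lemma rep_sum_irreducible_zero: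
  assumes \<rho>: "irreducible_rep G n \<rho>" and f: "class_function f"
    and 0: "(\<Sum>g\<in>carrier G. f g * rep_character G \<rho> g) = 0"
  shows "rep_sum n \<rho> f = 0\<^sub>m n n"
proof -
  note r = irreducible_rep_is_rep[OF \<rho>]
  obtain c where c: "rep_sum n \<rho> f = c \<cdot>\<^sub>m 1\<^sub>m n"
    using schur_scalar[OF \<rho> rep_sum_carrier rep_sum_commutes[OF r f]] by blast
  have "c * of_nat n = mat_trace (rep_sum n \<rho> f)"
    by (simp add: c mat_trace_smult[of _ n] mat_trace_one)
  also have "\<dots> = 0" using mat_trace_rep_sum[OF r] 0 by simp
  finally have "c = 0" using irreducible_rep_degree_pos[OF \<rho>] by simp
  then show ?thesis using c by (auto intro!: eq_matI)
qed

section \<open>Completeness of the irreducible characters\<close>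

text \<open>The restriction of \<open>\<rho>\<close> to an invariant subspace \<open>W\<close>, written in coordinates with respect to a basis
  of \<open>W\<close> that forms the columns of \<open>Q\<close>.\<close>

lemma subrepresentation:
  assumes r: "is_rep G n \<rho>" and W: "vec_subspace n W"
    and inv: "\<And>g w. g \<in> carrier G \<Longrightarrow> w \<in> W \<Longrightarrow> \<rho> g *\<^sub>v w \<in> W"
  shows "\<exists>e Q \<sigma>. inj_mat n e Q \<and> W = {Q *\<^sub>v v | v. v \<in> carrier_vec e} \<and> is_rep G e \<sigma> \<and>
    (\<forall>g\<in>carrier G. \<rho> g * Q = Q * \<sigma> g)"
proof -
  note rc = is_rep_carrier[OF r]
  obtain e Q where Q: "inj_mat n e Q" and WQ: "W = {Q *\<^sub>v v | v. v \<in> carrier_vec e}"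
    using vec_subspace_eq_range[OF W] .
  have Qc: "Q \<in> carrier_mat n e" using Q by (simp add: inj_mat_def)
  have "\<exists>M. M \<in> carrier_mat e e \<and> \<rho> g * Q = Q * M" if g: "g \<in> carrier G" for g
  proof -
    have rQ: "\<rho> g * Q \<in> carrier_mat n e" using rc[OF g] Qc by simp
    have "\<exists>v\<in>carrier_vec e. Q *\<^sub>v v = col (\<rho> g * Q) j" if j: "j < e" for j
    proof -
      have "col (\<rho> g * Q) j = \<rho> g *\<^sub>v col Q j" by (rule col_mult2[OF rc[OF g] Qc j])
      also have "col Q j = Q *\<^sub>v unit_vec e j" using Qc j by (intro eq_vecI) auto
      finally have eq: "col (\<rho> g * Q) j = \<rho> g *\<^sub>v (Q *\<^sub>v unit_vec e j)" .
      have "col (\<rho> g * Q) j \<in> W" unfolding eq by (rule inv[OF g]) (auto simp: WQ)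
      then show ?thesis using WQ by auto
    qed
    from factor_through_columns[OF Qc rQ this] show ?thesis by blast
  qed
  then obtain \<sigma> where \<sigma>: "\<And>g. g \<in> carrier G \<Longrightarrow> \<sigma> g \<in> carrier_mat e e"
    "\<And>g. g \<in> carrier G \<Longrightarrow> \<rho> g * Q = Q * \<sigma> g" by metis
  have "is_rep G e \<sigma>"
  proof (rule is_repI)
    fix g h assume g: "g \<in> carrier G" and h: "h \<in> carrier G"
    have "Q * \<sigma> (g \<otimes> h) = \<rho> g * \<rho> h * Q" using g h \<sigma>(2)[of "g \<otimes> h"] by (simp add: is_rep_mult[OF r])
    also have "\<dots> = \<rho> g * (Q * \<sigma> h)" using \<sigma>(2)[OF h] rc[OF g] rc[OF h] Qc by simp
    also have "\<dots> = Q * \<sigma> g * \<sigma> h" using \<sigma>(2)[OF g] \<sigma>(1) rc[OF g] g h Qc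
      by (metis assoc_mult_mat)
    also have "\<dots> = Q * (\<sigma> g * \<sigma> h)" using \<sigma>(1)[OF g] \<sigma>(1)[OF h] Qc by simp
    finally show "\<sigma> (g \<otimes> h) = \<sigma> g * \<sigma> h"
      by (rule inj_mat_cancel[OF Q \<sigma>(1)[OF m_closed[OF g h]] mult_carrier_mat[OF \<sigma>(1)[OF g] \<sigma>(1)[OF h]]])
  next
    have "Q * \<sigma> \<one> = Q * 1\<^sub>m e" using \<sigma>(2)[of \<one>] is_rep_one[OF r] Qc by simp
    then show "\<sigma> \<one> = 1\<^sub>m e" by (rule inj_mat_cancel[OF Q \<sigma>(1)[OF one_closed] one_carrier_mat])
  qed (fact \<sigma>(1))
  with Q WQ \<sigma>(2) show ?thesis by blast
qed

text \<open>Passing to a proper invariant subspace lowers the degree, so the process ends with an irreducible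
  representation.\<close>

lemma irreducible_subrepresentation:
  assumes "is_rep G n \<rho>" "n > 0"
  shows "\<exists>d Q \<sigma>. irreducible_rep G d \<sigma> \<and> inj_mat n d Q \<and> (\<forall>g\<in>carrier G. \<rho> g * Q = Q * \<sigma> g)"
  using assms
proof (induction n arbitrary: \<rho> rule: less_induct)
  case (less n)
  note r = less.prems(1)
  show ?case
  proof (cases "irreducible_rep G n \<rho>")
    case True
    moreover have "\<rho> g * 1\<^sub>m n = 1\<^sub>m n * \<rho> g" if "g \<in> carrier G" for g
      using is_rep_carrier[OF r that] by simp
    moreover have "inj_mat n n (1\<^sub>m n)" by (simp add: inj_mat_def)
    ultimately show ?thesis by blast
  next
    case False
    then obtain W where W: "vec_subspace n W" "\<And>g w. g \<in> carrier G \<Longrightarrow> w \<in> W \<Longrightarrow> \<rho> g *\<^sub>v w \<in> W"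
      and W': "W \<noteq> {0\<^sub>v n}" "W \<noteq> carrier_vec n"
      using less.prems by (auto simp: irreducible_rep_def invariant_subspace_def vec_subspace_iff)
    obtain e Q \<sigma> where Q: "inj_mat n e Q" "W = {Q *\<^sub>v v | v. v \<in> carrier_vec e}" and s: "is_rep G e \<sigma>"
      and comm: "\<And>g. g \<in> carrier G \<Longrightarrow> \<rho> g * Q = Q * \<sigma> g"
      using subrepresentation[OF r W] by blast
    have Qc: "Q \<in> carrier_mat n e" using Q by (simp add: inj_mat_def)
    have "e > 0"
    proof (rule ccontr)
      assume "\<not> e > 0"
      then have "Q *\<^sub>v v = 0\<^sub>v n" if "v \<in> carrier_vec e" for v
        using that Qc by (intro eq_vecI) (auto simp: scalar_prod_def)
      then have "W \<subseteq> {0\<^sub>v n}" unfolding Q(2) by auto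
      moreover have "0\<^sub>v n \<in> W" using W(1) by (simp add: vec_subspace_def)
      ultimately show False using W'(1) by auto
    qed
    moreover have "e < n"
    proof (rule ccontr)
      assume "\<not> e < n"
      with inj_mat_dim_le[OF Q(1)] have e: "e = n" by simp
      obtain B where B: "B \<in> carrier_mat n n" "Q * B = 1\<^sub>m n"
        using inj_mat_square_inverse Q(1) e by blast
      have "v \<in> W" if v: "v \<in> carrier_vec n" for v
      proof -
        have "v = (Q * B) *\<^sub>v v" using B(2) v by simp
        also have "\<dots> = Q *\<^sub>v (B *\<^sub>v v)" using Qc B(1) v e by simp
        finally show ?thesis unfolding Q(2) using B(1) v e by auto
      qed
      then show False using W'(2) W(1) by (auto simp: vec_subspace_def)
    qed
    ultimately obtain d P \<tau> where P: "irreducible_rep G d \<tau>" "inj_mat e d P"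
      "\<And>g. g \<in> carrier G \<Longrightarrow> \<sigma> g * P = P * \<tau> g"
      using less.IH[OF _ s] by blast
    have Pc: "P \<in> carrier_mat e d" using P by (simp add: inj_mat_def)
    have "\<rho> g * (Q * P) = Q * P * \<tau> g" if g: "g \<in> carrier G" for g
    proof -
      have rg: "\<rho> g \<in> carrier_mat n n" and sg: "\<sigma> g \<in> carrier_mat e e" and tg: "\<tau> g \<in> carrier_mat d d"
        using is_rep_carrier[OF r g] is_rep_carrier[OF s g]
          is_rep_carrier[OF irreducible_rep_is_rep[OF P(1)] g] .
      have "\<rho> g * (Q * P) = \<rho> g * Q * P" using rg Qc Pc by simp
      also have "\<dots> = Q * (\<sigma> g * P)" using comm[OF g] sg Qc Pc by simp
      also have "\<dots> = Q * P * \<tau> g" using P(3)[OF g] tg Qc Pc by simp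
      finally show ?thesis .
    qed
    then show ?thesis using P(1) inj_mat_mult[OF Q(1) P(2)] by blast
  qed
qed

text \<open>The group acts by permutation matrices on an enumeration of its elements. Left multiplication by an
  element other than \<open>\<one>\<close> has no fixed points, which determines the trace.\<close>

lemma regular_representation:
  "\<exists>R. is_rep G (card (carrier G)) R \<and>
    (\<forall>f. mat_trace (rep_sum (card (carrier G)) R f) = ord_G * f \<one>)"
proof -
  define N where "N = card (carrier G)"
  obtain e where e: "bij_betw e {0..<N} (carrier G)"
    using ex_bij_betw_nat_finite[OF fin] by (auto simp: N_def)
  have eG: "e i \<in> carrier G" if "i < N" for i using bij_betwE[OF e] that by simp
  have einj: "e i = e j \<longleftrightarrow> i = j" if "i < N" "j < N" for i j
    using bij_betw_imp_inj_on[OF e] that by (auto simp: inj_on_def)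
  define R where "R g = mat N N (\<lambda>(i, j). if e i = g \<otimes> e j then 1 else 0 :: complex)" for g
  have Rc: "R g \<in> carrier_mat N N" for g by (simp add: R_def)
  have R: "is_rep G N R"
  proof (rule is_repI)
    fix g h assume g: "g \<in> carrier G" and h: "h \<in> carrier G"
    show "R (g \<otimes> h) = R g * R h"
    proof (rule eq_matI)
      fix i j assume "i < dim_row (R g * R h)" "j < dim_col (R g * R h)"
      then have ij: "i < N" "j < N" by (auto simp: R_def)
      have "(R g * R h) $$ (i, j) =
        (\<Sum>l\<in>{0..<N}. (\<lambda>x. if x = h \<otimes> e j then if e i = g \<otimes> x then 1 else 0 else 0) (e l))"
      proof -
        have "(R g * R h) $$ (i, j) = (\<Sum>l\<in>{0..<N}. R g $$ (i, l) * R h $$ (l, j))"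
          using ij Rc[of g] Rc[of h] by (simp add: scalar_prod_def)
        also have "\<dots> = (\<Sum>l\<in>{0..<N}. (\<lambda>x. if x = h \<otimes> e j then if e i = g \<otimes> x then 1 else 0 else 0) (e l))"
          by (rule sum.cong[OF refl]) (use ij in \<open>simp add: R_def\<close>)
        finally show ?thesis .
      qed
      also have "\<dots> = (\<Sum>x\<in>carrier G. if x = h \<otimes> e j then if e i = g \<otimes> x then 1 else 0 else 0)"
        by (rule sum.reindex_bij_betw[OF e])
      also have "\<dots> = (if e i = g \<otimes> (h \<otimes> e j) then 1 else 0)"
        using fin h eG[OF ij(2)] by simp
      also have "\<dots> = R (g \<otimes> h) $$ (i, j)"
        using ij g h eG[OF ij(2)] by (simp add: R_def m_assoc)
      finally show "R (g \<otimes> h) $$ (i, j) = (R g * R h) $$ (i, j)" ..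
    qed (auto simp: R_def)
  next
    show "R \<one> = 1\<^sub>m N" by (rule eq_matI) (auto simp: R_def eG einj)
  qed (simp add: R_def)
  have "mat_trace (rep_sum N R f) = ord_G * f \<one>" for f
  proof -
    have "mat_trace (R g) = (if g = \<one> then ord_G else 0)" if g: "g \<in> carrier G" for g
    proof -
      have "e i = g \<otimes> e i \<longleftrightarrow> g = \<one>" if "i < N" for i
        using g eG[OF that] by (metis l_one r_cancel_one')
      then show ?thesis by (simp add: mat_trace_def R_def N_def)
    qed
    then show ?thesis using fin
      by (simp add: mat_trace_rep_sum[OF R] rep_character_trace if_distrib[of "\<lambda>x. _ * x"] cong: if_cong)
  qed
  with R show ?thesis by (auto simp: N_def)
qed

text \<open>The irreducible characters separate class functions: an \<open>f\<close> that is orthogonal to all of them acts as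
  zero in every irreducible representation, but if it were not zero then \<open>f\<close> convolved with its adjoint
  would act with nonzero trace in the regular representation.\<close>

lemma class_function_eq_zero:
  assumes f: "class_function f"
    and orth: "\<And>\<chi>. \<chi> \<in> Irr G \<Longrightarrow> (\<Sum>g\<in>carrier G. f g * \<chi> g) = 0"
    and g: "g \<in> carrier G"
  shows "f g = 0"
proof (rule ccontr)
  assume fg: "f g \<noteq> 0"
  \<comment> \<open>The coefficients of the product of the adjoint of \<open>f\<close> with \<open>f\<close>; its coefficient at \<open>\<one>\<close> is a sum of squares.\<close>
  define b where "b h = (\<Sum>x\<in>carrier G. cnj (f x) * f (x \<otimes> h))" for h
  have "class_function b"
    unfolding class_function_def
  proof (intro ballI)
    fix h y assume h: "h \<in> carrier G" and y: "y \<in> carrier G"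
    have "b (y \<otimes> h \<otimes> inv y) = (\<Sum>x\<in>carrier G. (\<lambda>x. cnj (f x) * f (x \<otimes> (y \<otimes> h \<otimes> inv y))) (y \<otimes> x \<otimes> inv y))"
      unfolding b_def by (rule sum.reindex_bij_betw[OF bij_conjugation[OF y], symmetric])
    also have "\<dots> = b h" unfolding b_def
    proof (rule sum.cong[OF refl])
      fix x assume x: "x \<in> carrier G"
      have "y \<otimes> x \<otimes> inv y \<otimes> (y \<otimes> h \<otimes> inv y) = y \<otimes> x \<otimes> (inv y \<otimes> y) \<otimes> h \<otimes> inv y"
        using x y h by (simp only: m_assoc m_closed inv_closed)
      also have "\<dots> = y \<otimes> (x \<otimes> h) \<otimes> inv y" using x y h by (simp add: m_assoc)
      finally show "cnj (f (y \<otimes> x \<otimes> inv y)) * f (y \<otimes> x \<otimes> inv y \<otimes> (y \<otimes> h \<otimes> inv y)) = cnj (f x) * f (x \<otimes> h)"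
        using x y h by (simp add: class_functionD[OF f])
    qed
    finally show "b (y \<otimes> h \<otimes> inv y) = b h" .
  qed
  note b = this
  \<comment> \<open>The trace of the action of \<open>b\<close> factors through the action of \<open>f\<close>, which is zero.\<close>
  have b_irr: "rep_sum n \<rho> b = 0\<^sub>m n n" if \<rho>: "irreducible_rep G n \<rho>" for n \<rho>
  proof (rule rep_sum_irreducible_zero[OF \<rho> b])
    note r = irreducible_rep_is_rep[OF \<rho>]
    have "rep_character G \<rho> \<in> Irr G" using \<rho> by (auto simp: Irr_def)
    then have f0: "rep_sum n \<rho> f = 0\<^sub>m n n"
      by (intro rep_sum_irreducible_zero[OF \<rho> f] orth)
    have inner: "(\<Sum>h\<in>carrier G. f (x \<otimes> h) * rep_character G \<rho> h) = 0" if x: "x \<in> carrier G" for x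
    proof -
      have rx: "\<rho> (inv x) \<in> carrier_mat n n" using is_rep_carrier[OF r] x by simp
      have "(\<Sum>h\<in>carrier G. f (x \<otimes> h) * rep_character G \<rho> h) =
        (\<Sum>h\<in>carrier G. (\<lambda>k. f k * mat_trace (\<rho> (inv x) * \<rho> k)) (x \<otimes> h))"
      proof (rule sum.cong[OF refl])
        fix h assume h: "h \<in> carrier G"
        have "\<rho> (inv x) * \<rho> (x \<otimes> h) = \<rho> (inv x \<otimes> (x \<otimes> h))" using x h by (simp add: is_rep_mult[OF r])
        also have "inv x \<otimes> (x \<otimes> h) = h" using x h by (simp add: m_assoc[symmetric])
        finally show "f (x \<otimes> h) * rep_character G \<rho> h = (\<lambda>k. f k * mat_trace (\<rho> (inv x) * \<rho> k)) (x \<otimes> h)"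
          using h by (simp add: rep_character_trace)
      qed
      also have "\<dots> = (\<Sum>k\<in>carrier G. f k * mat_trace (\<rho> (inv x) * \<rho> k))"
        by (rule sum.reindex_bij_betw[OF bij_mult_left[OF x]])
      also have "\<dots> = (\<Sum>k\<in>carrier G. mat_trace (\<rho> (inv x) * (f k \<cdot>\<^sub>m \<rho> k)))"
      proof (rule sum.cong[OF refl])
        fix k assume k: "k \<in> carrier G"
        show "f k * mat_trace (\<rho> (inv x) * \<rho> k) = mat_trace (\<rho> (inv x) * (f k \<cdot>\<^sub>m \<rho> k))"
          using rx is_rep_carrier[OF r k]
          by (simp add: mult_smult_distrib[of _ n n _ n] mat_trace_smult[of _ n])
      qed
      also have "\<dots> = mat_trace (mat_sum n n (carrier G) (\<lambda>k. \<rho> (inv x) * (f k \<cdot>\<^sub>m \<rho> k)))"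
        by (rule mat_trace_sum[symmetric]) (use rx is_rep_carrier[OF r] in auto)
      also have "\<dots> = mat_trace (\<rho> (inv x) * rep_sum n \<rho> f)"
        unfolding rep_sum_def by (subst mult_mat_sum[OF rx]) (use is_rep_carrier[OF r] in auto)
      also have "\<dots> = 0" using rx by (simp add: f0 mat_trace_def)
      finally show ?thesis .
    qed
    have "(\<Sum>h\<in>carrier G. b h * rep_character G \<rho> h) =
      (\<Sum>h\<in>carrier G. \<Sum>x\<in>carrier G. cnj (f x) * (f (x \<otimes> h) * rep_character G \<rho> h))"
      by (simp add: b_def sum_distrib_right mult.assoc)
    also have "\<dots> = (\<Sum>x\<in>carrier G. cnj (f x) * (\<Sum>h\<in>carrier G. f (x \<otimes> h) * rep_character G \<rho> h))"
      by (subst sum.swap) (simp add: sum_distrib_left)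
    also have "\<dots> = 0" by (simp add: inner)
    finally show "(\<Sum>h\<in>carrier G. b h * rep_character G \<rho> h) = 0" .
  qed
  have "b \<one> = (\<Sum>x\<in>carrier G. cnj (f x) * f x)" by (simp add: b_def cong: sum.cong)
  also have "\<dots> = of_real (\<Sum>x\<in>carrier G. (cmod (f x))\<^sup>2)"
    unfolding of_real_sum complex_norm_square by (simp add: mult.commute)
  finally have b1: "b \<one> = of_real (\<Sum>x\<in>carrier G. (cmod (f x))\<^sup>2)" .
  have "(\<Sum>x\<in>carrier G. (cmod (f x))\<^sup>2) > 0"
    by (rule sum_pos2[OF fin g]) (use fg in auto)
  then have b1: "b \<one> \<noteq> 0" unfolding b1 by (metis of_real_eq_0_iff less_irrefl)
  define N where "N = card (carrier G)"
  obtain R where R: "is_rep G N R" and tr: "\<forall>f. mat_trace (rep_sum N R f) = ord_G * f \<one>"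
    using regular_representation unfolding N_def by (elim exE conjE)
  from tr have trR: "mat_trace (rep_sum N R b) = ord_G * b \<one>" by (rule spec)
  define B where "B = rep_sum N R b"
  have Bc: "B \<in> carrier_mat N N" by (simp add: B_def)
  have "mat_trace B \<noteq> 0" using trR b1 ord_G_nonzero by (simp add: B_def)
  then obtain k where k: "eigenvalue B k" "k \<noteq> 0" using nonzero_trace_eigenvalue[OF Bc] by blast
  \<comment> \<open>The eigenspace of \<open>b\<close> in the regular representation; it is invariant because \<open>b\<close> is central.\<close>
  define W where "W = {v \<in> carrier_vec N. B *\<^sub>v v = k \<cdot>\<^sub>v v}"
  have W: "vec_subspace N W" unfolding vec_subspace_def W_def
    using Bc by (auto simp: mult_add_distrib_mat_vec[of B N N] mult_mat_vec[of B N N]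
        smult_add_distrib_vec[of _ N] smult_smult_assoc mult.commute)
  have Winv: "R h *\<^sub>v w \<in> W" if h: "h \<in> carrier G" and w: "w \<in> W" for h w
  proof -
    have rh: "R h \<in> carrier_mat N N" by (rule is_rep_carrier[OF R h])
    have wc: "w \<in> carrier_vec N" and Bw: "B *\<^sub>v w = k \<cdot>\<^sub>v w" using w by (auto simp: W_def)
    have "B *\<^sub>v (R h *\<^sub>v w) = R h *\<^sub>v (B *\<^sub>v w)"
      using rep_sum_commutes[OF R b h] Bc rh wc unfolding B_def by (metis assoc_mult_mat_vec)
    also have "\<dots> = k \<cdot>\<^sub>v (R h *\<^sub>v w)" using Bw rh wc by (simp add: mult_mat_vec)
    finally show ?thesis using rh wc by (auto simp: W_def)
  qed
  obtain e Q \<sigma> where Q: "inj_mat N e Q" "W = {Q *\<^sub>v v | v. v \<in> carrier_vec e}" and s: "is_rep G e \<sigma>"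
    and comm: "\<And>h. h \<in> carrier G \<Longrightarrow> R h * Q = Q * \<sigma> h"
    using subrepresentation[OF R W Winv] by blast
  have Qc: "Q \<in> carrier_mat N e" using Q by (simp add: inj_mat_def)
  have BQ: "B * Q = Q * rep_sum e \<sigma> b"
    unfolding B_def by (rule rep_sum_intertwines[OF R s Qc comm])
  have "e > 0"
  proof (rule ccontr)
    assume "\<not> e > 0"
    then have "Q *\<^sub>v v = 0\<^sub>v N" if "v \<in> carrier_vec e" for v
      using that Qc by (intro eq_vecI) (auto simp: scalar_prod_def)
    then have "w = 0\<^sub>v N" if "w \<in> W" for w using that Q(2) by auto
    then show False using k(1) Bc by (auto simp: eigenvalue_def eigenvector_def W_def)
  qed
  then obtain d P \<tau> where P: "irreducible_rep G d \<tau>" "inj_mat e d P"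
    "\<And>h. h \<in> carrier G \<Longrightarrow> \<sigma> h * P = P * \<tau> h"
    using irreducible_subrepresentation[OF s] by blast
  have Pc: "P \<in> carrier_mat e d" using P by (simp add: inj_mat_def)
  have "rep_sum e \<sigma> b * P = P * rep_sum d \<tau> b"
    by (rule rep_sum_intertwines[OF s irreducible_rep_is_rep[OF P(1)] Pc P(3)])
  also have "\<dots> = 0\<^sub>m e d" using b_irr[OF P(1)] Pc by simp
  finally have sP: "rep_sum e \<sigma> b * P = 0\<^sub>m e d" .
  have inj: "inj_mat N d (Q * P)" by (rule inj_mat_mult[OF Q(1) P(2)])
  define v :: "complex vec" where "v = unit_vec d 0"
  have d: "d > 0" by (rule irreducible_rep_degree_pos[OF P(1)])
  have v: "v \<in> carrier_vec d" "v \<noteq> 0\<^sub>v d" using d by (auto simp: v_def)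
  have Pv: "P *\<^sub>v v \<in> carrier_vec e" using Pc v by auto
  define w where "w = Q *\<^sub>v (P *\<^sub>v v)"
  have wc: "w \<in> carrier_vec N" using Qc Pv by (auto simp: w_def)
  have "w = (Q * P) *\<^sub>v v" using Qc Pc v by (simp add: w_def)
  then have w0: "w \<noteq> 0\<^sub>v N" using inj v by (auto simp: inj_mat_def)
  have "w \<in> W" using Q(2) Pv by (auto simp: w_def)
  then have "k \<cdot>\<^sub>v w = B *\<^sub>v w" by (simp add: W_def)
  also have "\<dots> = (B * Q) *\<^sub>v (P *\<^sub>v v)" using Bc Qc Pv by (simp add: w_def)
  also have "\<dots> = Q *\<^sub>v (rep_sum e \<sigma> b *\<^sub>v (P *\<^sub>v v))" unfolding BQ by (rule assoc_mult_mat_vec[OF Qc rep_sum_carrier Pv])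
  also have "rep_sum e \<sigma> b *\<^sub>v (P *\<^sub>v v) = (rep_sum e \<sigma> b * P) *\<^sub>v v"
    by (rule assoc_mult_mat_vec[OF rep_sum_carrier Pc v(1), symmetric])
  also have "\<dots> = 0\<^sub>v e" unfolding sP using v(1) by (intro eq_vecI) auto
  also have "Q *\<^sub>v 0\<^sub>v e = 0\<^sub>v N" using Qc by (intro eq_vecI) auto
  finally have kw: "k \<cdot>\<^sub>v w = 0\<^sub>v N" .
  have "w = 0\<^sub>v N"
  proof (rule eq_vecI)
    fix i assume "i < dim_vec (0\<^sub>v N :: complex vec)"
    then have i: "i < N" by simp
    then show "w $ i = 0\<^sub>v N $ i" using arg_cong[OF kw, of "\<lambda>x. x $ i"] wc k(2) by simp
  qed (use wc in simp)
  with w0 show False ..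
qed

section \<open>Irreducible characters as class functions\<close>

lemma Irr_class_function: 
  assumes "\<chi> \<in> Irr G"
  shows "class_function \<chi>"
  unfolding class_function_def
proof (intro ballI)
  fix g h assume g: "g \<in> carrier G" and h: "h \<in> carrier G"
  obtain n \<rho> where \<rho>: "irreducible_rep G n \<rho>" "\<chi> = rep_character G \<rho>"
    using assms by (auto simp: Irr_def)
  note r = irreducible_rep_is_rep[OF \<rho>(1)]
  have rg: "\<rho> g \<in> carrier_mat n n" and rh: "\<rho> h \<in> carrier_mat n n" and ri: "\<rho> (inv h) \<in> carrier_mat n n"
    using is_rep_carrier[OF r] g h by auto
  have "mat_trace (\<rho> (h \<otimes> g \<otimes> inv h)) = mat_trace (\<rho> h * \<rho> g * \<rho> (inv h))"
    using g h by (simp add: is_rep_mult[OF r])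
  also have "\<dots> = mat_trace (\<rho> (inv h) * (\<rho> h * \<rho> g))"
    using rg rh ri by (intro mat_trace_comm[of _ n n]) auto
  also have "\<rho> (inv h) * (\<rho> h * \<rho> g) = \<rho> (inv h) * \<rho> h * \<rho> g"
    using rg rh ri by simp
  also have "\<dots> = \<rho> g" using rg by (simp add: is_rep_inv[OF r h])
  finally show "\<chi> (h \<otimes> g \<otimes> inv h) = \<chi> g" using g h by (simp add: \<rho>(2) rep_character_trace)
qed

lemma orthogonality_cnj:
  assumes "\<chi> \<in> Irr G" "\<psi> \<in> Irr G"
  shows "(\<Sum>g\<in>carrier G. cnj (\<chi> g) * \<psi> g) = (if \<chi> = \<psi> then ord_G else 0)"
proof -
  have "(\<Sum>g\<in>carrier G. cnj (\<chi> g) * \<psi> g) = (\<Sum>g\<in>carrier G. \<psi> g * \<chi> (inv g))"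
    by (intro sum.cong refl) (simp add: Irr_inv[OF assms(1)] mult.commute)
  then show ?thesis using orthogonality[OF assms(2,1)] by auto
qed

text \<open>Orthogonality makes distinct irreducible characters linearly independent functions on a finite set.\<close>

lemma finite_Irr: "finite (Irr G)"
proof (rule ccontr)
  assume "infinite (Irr G)"
  then obtain S where S: "S \<subseteq> Irr G" "finite S" "card S = Suc (card (carrier G))"
    using infinite_arbitrarily_large by blast
  have "card S \<le> card (carrier G)"
  proof (rule independent_functions_card(1)[OF S(2) fin, where f = "\<lambda>\<chi> g. \<chi> g"])
    fix c \<psi> assume 0: "\<forall>g\<in>carrier G. (\<Sum>\<chi>\<in>S. c \<chi> * \<chi> g) = 0" and \<psi>: "\<psi> \<in> S"
    have "0 = (\<Sum>g\<in>carrier G. cnj (\<psi> g) * (\<Sum>\<chi>\<in>S. c \<chi> * \<chi> g))" using 0 by simp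
    also have "\<dots> = (\<Sum>g\<in>carrier G. \<Sum>\<chi>\<in>S. c \<chi> * (cnj (\<psi> g) * \<chi> g))"
      by (simp add: sum_distrib_left mult_ac)
    also have "\<dots> = (\<Sum>\<chi>\<in>S. c \<chi> * (\<Sum>g\<in>carrier G. cnj (\<psi> g) * \<chi> g))"
      by (subst sum.swap) (simp add: sum_distrib_left)
    also have "\<dots> = (\<Sum>\<chi>\<in>S. c \<chi> * (if \<psi> = \<chi> then ord_G else 0))"
      by (intro sum.cong refl arg_cong2[where f = "(*)"] orthogonality_cnj) (use S(1) \<psi> in auto)
    also have "\<dots> = c \<psi> * ord_G"
      using S(2) \<psi> by (simp add: if_distrib[of "\<lambda>x. _ * x"] cong: if_cong)
    finally show "c \<psi> = 0" using ord_G_nonzero by simp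
  qed
  with S(3) show False by simp
qed

section \<open>The Fourier transform of class functions\<close>

text \<open>For a class function \<open>f\<close> this is the central character of \<open>\<chi>\<close> at \<open>\<Sum>g. f g g\<close>. The indicator of a
  normal set \<open>K\<close> gives the quantity in the definition of \<open>IrPt\<close>, see \<open>omega_indicator\<close>.\<close>

definition omega :: "('a \<Rightarrow> complex) \<Rightarrow> ('a \<Rightarrow> complex) \<Rightarrow> complex" where
  "omega \<chi> f = (\<Sum>g\<in>carrier G. f g * \<chi> g) / \<chi> \<one>"

text \<open>The coefficient at \<open>g\<close> of the central idempotent of the group algebra that belongs to \<open>X\<close>, the sum of
  the primitive ones \<open>e\<^sub>\<chi> = (\<chi>(1)/|G|) \<Sum>g. \<chi>(g\<inverse>) g\<close> over \<open>\<chi> \<in> X\<close>.\<close>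

definition idem_coeff :: "('a \<Rightarrow> complex) set \<Rightarrow> 'a \<Rightarrow> complex" where
  "idem_coeff X g = cnj (sigma G X g) / ord_G"

lemma omega_sum: "finite I \<Longrightarrow> omega \<chi> (\<lambda>g. \<Sum>i\<in>I. c i * f i g) = (\<Sum>i\<in>I. c i * omega \<chi> (f i))"
  unfolding omega_def
  by (simp add: sum_distrib_right sum_divide_distrib sum_distrib_left mult.assoc) (rule sum.swap)

lemma omega_indicator:
  assumes "K \<subseteq> carrier G"
  shows "omega \<chi> (\<lambda>g. of_bool (g \<in> K)) = (\<Sum>g\<in>K. \<chi> g) / \<chi> \<one>"
proof -
  have "(\<Sum>g\<in>K. \<chi> g) = (\<Sum>g\<in>carrier G. of_bool (g \<in> K) * \<chi> g)"
    using assms fin by (intro sum.mono_neutral_cong_left) auto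
  then show ?thesis by (simp add: omega_def)
qed

lemma idem_coeff_sum: "X \<subseteq> Irr G \<Longrightarrow> idem_coeff X g = (\<Sum>\<chi>\<in>X. idem_coeff {\<chi>} g)"
  by (simp add: idem_coeff_def sigma_def sum_divide_distrib)

text \<open>The first orthogonality relation: the central idempotent of \<open>X\<close> acts as \<open>1\<close> in the representations
  belonging to \<open>X\<close> and as \<open>0\<close> in all others.\<close>

lemma omega_idem_coeff:
  assumes X: "X \<subseteq> Irr G" and \<psi>: "\<psi> \<in> Irr G"
  shows "omega \<psi> (idem_coeff X) = of_bool (\<psi> \<in> X)"
proof -
  have fX: "finite X" using X finite_Irr finite_subset by blast
  have "(\<Sum>g\<in>carrier G. idem_coeff X g * \<psi> g) =
      (\<Sum>g\<in>carrier G. \<Sum>\<chi>\<in>X. \<chi> \<one> * (cnj (\<chi> g) * \<psi> g) / ord_G)"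
  proof (rule sum.cong[OF refl])
    fix g
    show "idem_coeff X g * \<psi> g = (\<Sum>\<chi>\<in>X. \<chi> \<one> * (cnj (\<chi> g) * \<psi> g) / ord_G)"
      unfolding idem_coeff_def sigma_def cnj_sum sum_divide_distrib sum_distrib_right
      by (rule sum.cong[OF refl]) (use X Irr_one_real in auto)
  qed
  also have "\<dots> = (\<Sum>\<chi>\<in>X. \<chi> \<one> * (\<Sum>g\<in>carrier G. cnj (\<chi> g) * \<psi> g) / ord_G)"
    by (subst sum.swap) (simp add: sum_distrib_left sum_divide_distrib)
  also have "\<dots> = (\<Sum>\<chi>\<in>X. if \<chi> = \<psi> then \<chi> \<one> else 0)"
  proof (rule sum.cong[OF refl])
    fix \<chi> assume "\<chi> \<in> X"
    then have "\<chi> \<in> Irr G" using X by auto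
    from orthogonality_cnj[OF this \<psi>]
    show "\<chi> \<one> * (\<Sum>g\<in>carrier G. cnj (\<chi> g) * \<psi> g) / ord_G = (if \<chi> = \<psi> then \<chi> \<one> else 0)"
      using ord_G_nonzero by simp
  qed
  also have "\<dots> = of_bool (\<psi> \<in> X) * \<psi> \<one>" using fX by simp
  finally show ?thesis using Irr_one_nonzero[OF \<psi>] by (simp add: omega_def)
qed

lemma idem_coeff_class_function:
  assumes "X \<subseteq> Irr G"
  shows "class_function (idem_coeff X)"
  unfolding class_function_def idem_coeff_def sigma_def
  using assms Irr_class_function class_functionD
  by (auto intro!: arg_cong[where f = cnj] sum.cong)

lemma class_function_sum:
  "(\<And>i. i \<in> I \<Longrightarrow> class_function (f i)) \<Longrightarrow> class_function (\<lambda>g. \<Sum>i\<in>I. c i * f i g)"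
  by (simp add: class_function_def cong: sum.cong)

text \<open>Both sides have the same transform by orthogonality, and class functions with the same transform are
  equal by completeness.\<close>

lemma fourier_inversion:
  assumes f: "class_function f" and g: "g \<in> carrier G"
  shows "f g = (\<Sum>\<chi>\<in>Irr G. omega \<chi> f * idem_coeff {\<chi>} g)"
proof -
  define u where "u = (\<lambda>g. \<Sum>\<chi>\<in>Irr G. omega \<chi> f * idem_coeff {\<chi>} g)"
  have u: "class_function u" unfolding u_def
    by (rule class_function_sum) (simp add: idem_coeff_class_function)
  have om: "omega \<psi> u = omega \<psi> f" if \<psi>: "\<psi> \<in> Irr G" for \<psi>
  proof -
    have "omega \<psi> u = (\<Sum>\<chi>\<in>Irr G. omega \<chi> f * omega \<psi> (idem_coeff {\<chi>}))"
      unfolding u_def by (rule omega_sum[OF finite_Irr])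
    also have "\<dots> = (\<Sum>\<chi>\<in>Irr G. if \<chi> = \<psi> then omega \<chi> f else 0)"
      by (intro sum.cong refl) (use omega_idem_coeff[OF _ \<psi>] in auto)
    also have "\<dots> = omega \<psi> f" using \<psi> finite_Irr by simp
    finally show ?thesis .
  qed
  have "f g - u g = 0"
  proof (rule class_function_eq_zero[of "\<lambda>g. f g - u g", OF _ _ g])
    show "class_function (\<lambda>g. f g - u g)" using f u by (simp add: class_function_def)
    fix \<psi> assume \<psi>: "\<psi> \<in> Irr G"
    have "(\<Sum>g\<in>carrier G. u g * \<psi> g) = (\<Sum>g\<in>carrier G. f g * \<psi> g)"
      using om[OF \<psi>] Irr_one_nonzero[OF \<psi>] by (simp add: omega_def)
    then show "(\<Sum>g\<in>carrier G. (f g - u g) * \<psi> g) = 0"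
      by (simp add: left_diff_distrib sum_subtractf)
  qed
  then show ?thesis by (simp add: u_def)
qed

section \<open>Partitions of the group and of its irreducible characters\<close>

text \<open>The members are required to have indicators that are class functions, since it is to these indicators
  that the Fourier transform is applied.\<close>

definition normal_partition :: "'a set set \<Rightarrow> bool" where
  "normal_partition KK \<longleftrightarrow> partition_on (carrier G) KK \<and>
     (\<forall>K\<in>KK. class_function (\<lambda>g. of_bool (g \<in> K)))"

definition omega_constant :: "('a \<Rightarrow> complex) set set \<Rightarrow> 'a set set \<Rightarrow> bool" where
  "omega_constant XX KK \<longleftrightarrow> (\<forall>X\<in>XX. \<forall>K\<in>KK. \<forall>\<chi>\<in>X. \<forall>\<psi>\<in>X.
     omega \<chi> (\<lambda>g. of_bool (g \<in> K)) = omega \<psi> (\<lambda>g. of_bool (g \<in> K)))"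

definition sigma_constant :: "('a \<Rightarrow> complex) set set \<Rightarrow> 'a set set \<Rightarrow> bool" where
  "sigma_constant XX KK \<longleftrightarrow> (\<forall>X\<in>XX. \<forall>K\<in>KK. \<forall>g\<in>K. \<forall>h\<in>K. sigma G X g = sigma G X h)"

lemma idem_coeff_eq_iff_sigma_eq: "idem_coeff X g = idem_coeff X h \<longleftrightarrow> sigma G X g = sigma G X h"
  using ord_G_nonzero by (simp add: idem_coeff_def)

text \<open>Grouping the inversion formula for the indicator of \<open>K\<close> by the blocks of \<open>\<X>\<close>, on which the transform is
  constant, expresses the indicator through the functions \<open>\<sigma>\<^sub>X\<close>. It therefore cannot separate elements
  on which all \<open>\<sigma>\<^sub>X\<close> agree.\<close>

lemma same_sigma_same_block:
  assumes KK: "normal_partition KK" and XX: "partition_on (Irr G) XX" and om: "omega_constant XX KK"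
    and K: "K \<in> KK" and g: "g \<in> K" and h: "h \<in> carrier G"
    and eq: "\<And>X. X \<in> XX \<Longrightarrow> sigma G X g = sigma G X h"
  shows "h \<in> K"
proof -
  let ?k = "\<lambda>g. of_bool (g \<in> K) :: complex"
  obtain r where r: "\<And>X. X \<in> XX \<Longrightarrow> r X \<in> X" using partition_representatives[OF XX] by metis
  have k: "?k x = (\<Sum>X\<in>XX. omega (r X) ?k * idem_coeff X x)" if x: "x \<in> carrier G" for x
  proof -
    have "?k x = (\<Sum>\<chi>\<in>Irr G. omega \<chi> ?k * idem_coeff {\<chi>} x)"
      using KK K x by (intro fourier_inversion) (auto simp: normal_partition_def)
    also have "\<dots> = (\<Sum>X\<in>XX. \<Sum>\<chi>\<in>X. omega \<chi> ?k * idem_coeff {\<chi>} x)"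
      by (rule partition_on_sum[OF XX finite_Irr])
    also have "\<dots> = (\<Sum>X\<in>XX. omega (r X) ?k * idem_coeff X x)"
    proof (rule sum.cong[OF refl])
      fix X assume X: "X \<in> XX"
      then have XI: "X \<subseteq> Irr G" using partition_onD1[OF XX] by auto
      have "(\<Sum>\<chi>\<in>X. omega \<chi> ?k * idem_coeff {\<chi>} x) = (\<Sum>\<chi>\<in>X. omega (r X) ?k * idem_coeff {\<chi>} x)"
        by (intro sum.cong refl arg_cong2[where f = "(*)"])
          (use om X K r[OF X] in \<open>unfold omega_constant_def; blast\<close>)
      then show "(\<Sum>\<chi>\<in>X. omega \<chi> ?k * idem_coeff {\<chi>} x) = omega (r X) ?k * idem_coeff X x"
        by (simp add: idem_coeff_sum[OF XI] sum_distrib_left)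
    qed
    finally show ?thesis .
  qed
  have gG: "g \<in> carrier G" using KK K g partition_onD1 by (auto simp: normal_partition_def)
  have "?k g = ?k h" unfolding k[OF gG] k[OF h]
    by (intro sum.cong refl arg_cong2[where f = "(*)"]) (simp add: idem_coeff_eq_iff_sigma_eq eq)
  then show ?thesis using g by (simp split: if_splits)
qed

text \<open>The indicator of \<open>X\<close> is the transform of its idempotent. The latter is constant on the blocks of \<open>\<K>\<close>,
  so the indicator of \<open>X\<close> is a combination of the transforms of the blocks.\<close>

lemma same_omega_same_block:
  assumes KK: "partition_on (carrier G) KK" and XX: "partition_on (Irr G) XX" and si: "sigma_constant XX KK"
    and X: "X \<in> XX" and \<chi>: "\<chi> \<in> X" and \<psi>: "\<psi> \<in> Irr G"
    and eq: "\<And>K. K \<in> KK \<Longrightarrow> omega \<chi> (\<lambda>g. of_bool (g \<in> K)) = omega \<psi> (\<lambda>g. of_bool (g \<in> K))"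
  shows "\<psi> \<in> X"
proof -
  have XI: "X \<subseteq> Irr G" using partition_onD1[OF XX] X by auto
  obtain r where r: "\<And>K. K \<in> KK \<Longrightarrow> r K \<in> K" using partition_representatives[OF KK] by metis
  have expand: "idem_coeff X g = (\<Sum>K\<in>KK. idem_coeff X (r K) * of_bool (g \<in> K))" if g: "g \<in> carrier G" for g
  proof -
    obtain K where K: "K \<in> KK" "g \<in> K" using g partition_onD1[OF KK] by auto
    have "idem_coeff X (r K) = idem_coeff X g"
      using si X K r[OF K(1)] unfolding idem_coeff_eq_iff_sigma_eq sigma_constant_def by blast
    then show ?thesis
      using partition_sum_of_bool[OF KK fin K, of "\<lambda>K. idem_coeff X (r K)"] by simp
  qed
  have ob: "of_bool (\<phi> \<in> X) = (\<Sum>K\<in>KK. idem_coeff X (r K) * omega \<phi> (\<lambda>g. of_bool (g \<in> K)))"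
    if \<phi>: "\<phi> \<in> Irr G" for \<phi>
  proof -
    have "of_bool (\<phi> \<in> X) = omega \<phi> (idem_coeff X)" using omega_idem_coeff[OF XI \<phi>] by simp
    also have "\<dots> = omega \<phi> (\<lambda>g. \<Sum>K\<in>KK. idem_coeff X (r K) * of_bool (g \<in> K))"
      unfolding omega_def using expand by (simp cong: sum.cong)
    also have "\<dots> = (\<Sum>K\<in>KK. idem_coeff X (r K) * omega \<phi> (\<lambda>g. of_bool (g \<in> K)))"
      by (rule omega_sum[OF finite_elements[OF fin KK]])
    finally show ?thesis .
  qed
  have "\<chi> \<in> Irr G" using XI \<chi> by blast
  then have "(of_bool (\<chi> \<in> X) :: complex) = of_bool (\<psi> \<in> X)"
    unfolding ob[OF \<psi>] by (subst ob) (auto intro!: sum.cong simp: eq)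
  then show ?thesis using \<chi> by (simp split: if_splits)
qed

text \<open>A partition of \<open>G\<close> whose transforms are constant on the blocks of \<open>\<X>\<close> cannot have more blocks than
  \<open>\<X>\<close>. In the case of equality the transforms span all functions constant on the blocks of \<open>\<X>\<close>. So the
  indicator of a block \<open>X\<close> is the transform of a function that is constant on the blocks of \<open>\<K>\<close>, and by
  inversion this function is the idempotent of \<open>X\<close>.\<close>

lemma omega_constant_card:
  assumes KK: "normal_partition KK" and XX: "partition_on (Irr G) XX" and om: "omega_constant XX KK"
  shows "card KK \<le> card XX"
    and "card KK = card XX \<Longrightarrow> sigma_constant XX KK"
proof -
  let ?k = "\<lambda>K g. of_bool (g \<in> K) :: complex"
  have KKp: "partition_on (carrier G) KK" and cf: "\<And>K. K \<in> KK \<Longrightarrow> class_function (?k K)"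
    using KK by (auto simp: normal_partition_def)
  have fK: "finite KK" and fX: "finite XX"
    using finite_elements[OF fin KKp] finite_elements[OF finite_Irr XX] .
  obtain r where r: "\<And>X. X \<in> XX \<Longrightarrow> r X \<in> X" using partition_representatives[OF XX] by metis
  have combine: "(\<Sum>K\<in>KK. c K * omega \<chi> (?k K)) = (\<Sum>K\<in>KK. c K * omega (r X) (?k K))"
    if "X \<in> XX" "\<chi> \<in> X" for c X \<chi>
    by (intro sum.cong refl arg_cong2[where f = "(*)"])
      (use om r that in \<open>unfold omega_constant_def; blast\<close>)
  have invert: "c K = (\<Sum>\<chi>\<in>Irr G. a \<chi> * idem_coeff {\<chi>} g)"
    if a: "\<And>\<chi>. \<chi> \<in> Irr G \<Longrightarrow> (\<Sum>K\<in>KK. c K * omega \<chi> (?k K)) = a \<chi>" and K: "K \<in> KK" "g \<in> K"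
    for a c K g
  proof -
    \<comment> \<open>The function with value \<open>c K\<close> on each block \<open>K\<close>; its transform is \<open>a\<close>.\<close>
    let ?u = "\<lambda>g. \<Sum>K\<in>KK. c K * ?k K g"
    have g: "g \<in> carrier G" using K partition_onD1[OF KKp] by auto
    have "c K = ?u g" using partition_sum_of_bool[OF KKp fin K] by simp
    also have "\<dots> = (\<Sum>\<chi>\<in>Irr G. omega \<chi> ?u * idem_coeff {\<chi>} g)"
      by (rule fourier_inversion[OF class_function_sum[OF cf] g])
    also have "\<dots> = (\<Sum>\<chi>\<in>Irr G. a \<chi> * idem_coeff {\<chi>} g)"
      by (intro sum.cong refl) (simp only: omega_sum[OF fK] a)
    finally show ?thesis .
  qed
  have indep: "c K = 0" if c: "\<forall>X\<in>XX. (\<Sum>K\<in>KK. c K * omega (r X) (?k K)) = 0" and K: "K \<in> KK" for c K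
  proof -
    obtain g where g: "g \<in> K" using K partition_onD3[OF KKp] by (metis ex_in_conv)
    have "(\<Sum>K\<in>KK. c K * omega \<chi> (?k K)) = 0" if "\<chi> \<in> Irr G" for \<chi>
    proof -
      obtain X where "X \<in> XX" "\<chi> \<in> X" using \<open>\<chi> \<in> Irr G\<close> partition_onD1[OF XX] by auto
      then show ?thesis using combine c by simp
    qed
    from invert[OF this K g] show ?thesis by simp
  qed
  show "card KK \<le> card XX"
    by (rule independent_functions_card(1)[OF fK fX, where f = "\<lambda>K X. omega (r X) (?k K)"]) (fact indep)
  assume eq: "card KK = card XX"
  show "sigma_constant XX KK"
    unfolding sigma_constant_def
  proof (intro ballI)
    fix X K g h assume X: "X \<in> XX" and K: "K \<in> KK" and g: "g \<in> K" and h: "h \<in> K"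
    have XI: "X \<subseteq> Irr G" using partition_onD1[OF XX] X by auto
    have "\<exists>c. \<forall>Y\<in>XX. (\<Sum>K\<in>KK. c K * omega (r Y) (?k K)) = of_bool (Y = X)"
      by (rule independent_functions_card(2)[OF fK fX _ eq,
            where f = "\<lambda>K X. omega (r X) (?k K)"]) (fact indep)
    then obtain c where c: "\<forall>Y\<in>XX. (\<Sum>K\<in>KK. c K * omega (r Y) (?k K)) = of_bool (Y = X)" ..
    have val: "(\<Sum>K\<in>KK. c K * omega \<chi> (?k K)) = of_bool (\<chi> \<in> X)" if "\<chi> \<in> Irr G" for \<chi>
    proof -
      obtain Y where Y: "Y \<in> XX" "\<chi> \<in> Y" using \<open>\<chi> \<in> Irr G\<close> partition_onD1[OF XX] by auto
      have "Y = X \<longleftrightarrow> \<chi> \<in> X" using partition_on_block_eq[OF XX Y(1) X Y(2)] Y(2) by auto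
      then show ?thesis using combine[OF Y] c Y(1) by simp
    qed
    have inv: "c K = (\<Sum>\<chi>\<in>Irr G. of_bool (\<chi> \<in> X) * idem_coeff {\<chi>} x)" if "x \<in> K" for x
      by (rule invert[OF _ K that]) (rule val)
    have "(\<Sum>\<chi>\<in>Irr G. of_bool (\<chi> \<in> X) * idem_coeff {\<chi>} x) = idem_coeff X x" for x
      unfolding idem_coeff_sum[OF XI] using XI finite_Irr by (intro sum.mono_neutral_cong_right) auto
    then have "idem_coeff X g = idem_coeff X h" using inv[OF g] inv[OF h] by simp
    then show "sigma G X g = sigma G X h" by (simp add: idem_coeff_eq_iff_sigma_eq)
  qed
qed

text \<open>The counterpart of \<open>omega_constant_card\<close> on the other side of the transform: here the idempotents of
  the blocks of \<open>\<X>\<close> are independent functions constant on the blocks of \<open>\<K>\<close>. In the case of equality the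
  indicator of a block \<open>K\<close> is a combination of them, and its transform a combination of indicators of
  blocks of \<open>\<X>\<close>.\<close>

lemma sigma_constant_card:
  assumes KK: "partition_on (carrier G) KK" and XX: "partition_on (Irr G) XX" and si: "sigma_constant XX KK"
  shows "card XX \<le> card KK"
    and "card XX = card KK \<Longrightarrow> omega_constant XX KK"
proof -
  have fK: "finite KK" and fX: "finite XX"
    using finite_elements[OF fin KK] finite_elements[OF finite_Irr XX] .
  obtain r where r: "\<And>K. K \<in> KK \<Longrightarrow> r K \<in> K" using partition_representatives[OF KK] by metis
  have idem_coeff_r: "idem_coeff X g = idem_coeff X (r K)" if "X \<in> XX" "K \<in> KK" "g \<in> K" for X K g
    using si that r[OF that(2)] unfolding idem_coeff_eq_iff_sigma_eq sigma_constant_def by blast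
  have coeff: "omega \<chi> f = c X"
    if f: "\<And>g. g \<in> carrier G \<Longrightarrow> f g = (\<Sum>X\<in>XX. c X * idem_coeff X g)" and X: "X \<in> XX" "\<chi> \<in> X" for f c X \<chi>
  proof -
    have \<chi>: "\<chi> \<in> Irr G" using X partition_onD1[OF XX] by auto
    have "omega \<chi> f = omega \<chi> (\<lambda>g. \<Sum>X\<in>XX. c X * idem_coeff X g)"
      unfolding omega_def using f by (simp cong: sum.cong)
    also have "\<dots> = (\<Sum>X\<in>XX. c X * omega \<chi> (idem_coeff X))" by (rule omega_sum[OF fX])
    also have "\<dots> = (\<Sum>X\<in>XX. c X * of_bool (\<chi> \<in> X))"
      by (intro sum.cong refl arg_cong2[where f = "(*)"] omega_idem_coeff \<chi>) (use partition_onD1[OF XX] in auto)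
    also have "\<dots> = c X" by (rule partition_sum_of_bool[OF XX finite_Irr X])
    finally show ?thesis .
  qed
  have combine: "(\<Sum>X\<in>XX. c X * idem_coeff X g) = (\<Sum>X\<in>XX. c X * idem_coeff X (r K))"
    if "K \<in> KK" "g \<in> K" for c K g
    by (intro sum.cong refl arg_cong2[where f = "(*)"] idem_coeff_r that)
  have indep: "c X = 0" if c: "\<forall>K\<in>KK. (\<Sum>X\<in>XX. c X * idem_coeff X (r K)) = 0" and X: "X \<in> XX" for c X
  proof -
    obtain \<chi> where \<chi>: "\<chi> \<in> X" using X partition_onD3[OF XX] by (metis ex_in_conv)
    have "0 = (\<Sum>X\<in>XX. c X * idem_coeff X g)" if "g \<in> carrier G" for g
    proof -
      obtain K where "K \<in> KK" "g \<in> K" using \<open>g \<in> carrier G\<close> partition_onD1[OF KK] by auto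
      then show ?thesis using combine c by simp
    qed
    from coeff[where f = "\<lambda>g. 0", OF this X \<chi>] show ?thesis by (simp add: omega_def)
  qed
  show "card XX \<le> card KK"
    by (rule independent_functions_card(1)[OF fX fK, where f = "\<lambda>X K. idem_coeff X (r K)"]) (fact indep)
  assume eq: "card XX = card KK"
  show "omega_constant XX KK"
    unfolding omega_constant_def
  proof (intro ballI)
    fix X K \<chi> \<psi> assume X: "X \<in> XX" and K: "K \<in> KK" and \<chi>: "\<chi> \<in> X" and \<psi>: "\<psi> \<in> X"
    have "\<exists>c. \<forall>L\<in>KK. (\<Sum>X\<in>XX. c X * idem_coeff X (r L)) = of_bool (L = K)"
      by (rule independent_functions_card(2)[OF fX fK _ eq,
            where f = "\<lambda>X K. idem_coeff X (r K)"]) (fact indep)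
    then obtain c where c: "\<forall>L\<in>KK. (\<Sum>X\<in>XX. c X * idem_coeff X (r L)) = of_bool (L = K)" ..
    have val: "of_bool (g \<in> K) = (\<Sum>X\<in>XX. c X * idem_coeff X g)" if "g \<in> carrier G" for g
    proof -
      obtain L where L: "L \<in> KK" "g \<in> L" using \<open>g \<in> carrier G\<close> partition_onD1[OF KK] by auto
      have "L = K \<longleftrightarrow> g \<in> K" using partition_on_block_eq[OF KK L(1) K L(2)] L(2) by auto
      then show ?thesis using combine[OF L] c L(1) by simp
    qed
    have co: "omega \<phi> (\<lambda>g. of_bool (g \<in> K)) = c X" if "\<phi> \<in> X" for \<phi>
      by (rule coeff[OF _ X that]) (rule val)
    show "omega \<chi> (\<lambda>g. of_bool (g \<in> K)) = omega \<psi> (\<lambda>g. of_bool (g \<in> K))"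
      using co[OF \<chi>] co[OF \<psi>] by simp
  qed
qed

section \<open>The partitions ClPt and IrPt\<close>

lemma IrPt_equiv: "equiv (Irr G) {(\<chi>, \<psi>) \<in> Irr G \<times> Irr G.
    \<forall>K\<in>KK. (\<Sum>g\<in>K. \<chi> g) / \<chi> \<one> = (\<Sum>g\<in>K. \<psi> g) / \<psi> \<one>}" (is "equiv _ ?r")
  by (rule equivI) (auto simp: refl_on_def sym_def trans_def)

lemma ClPt_equiv: "equiv (carrier G) {(g, h) \<in> carrier G \<times> carrier G. \<forall>X\<in>XX. sigma G X g = sigma G X h}"
  by (rule equivI) (auto simp: refl_on_def sym_def trans_def)

lemma partition_on_IrPt: "partition_on (Irr G) (IrPt G KK)"
  unfolding IrPt_def by (rule partition_on_quotient[OF IrPt_equiv])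

lemma partition_on_ClPt: "partition_on (carrier G) (ClPt G XX)"
  unfolding ClPt_def by (rule partition_on_quotient[OF ClPt_equiv])

lemma mem_IrPt_block_iff:
  assumes KK: "partition_on (carrier G) KK" and X: "X \<in> IrPt G KK" "\<chi> \<in> X" and \<psi>: "\<psi> \<in> Irr G"
  shows "\<psi> \<in> X \<longleftrightarrow> (\<forall>K\<in>KK. omega \<chi> (\<lambda>g. of_bool (g \<in> K)) = omega \<psi> (\<lambda>g. of_bool (g \<in> K)))"
proof -
  have \<chi>: "\<chi> \<in> Irr G" using partition_onD1[OF partition_on_IrPt] X by auto
  let ?r = "{(\<chi>, \<psi>) \<in> Irr G \<times> Irr G.
    \<forall>K\<in>KK. (\<Sum>g\<in>K. \<chi> g) / \<chi> \<one> = (\<Sum>g\<in>K. \<psi> g) / \<psi> \<one>}"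
  have Xq: "X \<in> Irr G // ?r" using X(1) by (simp add: IrPt_def)
  have "\<psi> \<in> X \<longleftrightarrow> (\<chi>, \<psi>) \<in> ?r"
    using in_quotient_imp_in_rel[OF IrPt_equiv Xq] in_quotient_imp_closed[OF IrPt_equiv Xq] X(2) by blast
  moreover have "K \<subseteq> carrier G" if "K \<in> KK" for K using that partition_onD1[OF KK] by auto
  ultimately show ?thesis using \<chi> \<psi> by (simp add: omega_indicator)
qed

lemma mem_ClPt_block_iff:
  assumes K: "K \<in> ClPt G XX" "g \<in> K" and h: "h \<in> carrier G"
  shows "h \<in> K \<longleftrightarrow> (\<forall>X\<in>XX. sigma G X g = sigma G X h)"
proof -
  have g: "g \<in> carrier G" using partition_onD1[OF partition_on_ClPt] K by auto
  have Kq: "K \<in> carrier G // {(g, h) \<in> carrier G \<times> carrier G. \<forall>X\<in>XX. sigma G X g = sigma G X h}"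
    using K(1) by (simp add: ClPt_def)
  show ?thesis
    using in_quotient_imp_in_rel[OF ClPt_equiv Kq] in_quotient_imp_closed[OF ClPt_equiv Kq] K(2) g h by blast
qed

lemma omega_constant_IrPt:
  assumes "partition_on (carrier G) KK"
  shows "omega_constant (IrPt G KK) KK"
  unfolding omega_constant_def
proof (intro ballI)
  fix X K \<chi> \<psi> assume "X \<in> IrPt G KK" "K \<in> KK" "\<chi> \<in> X" "\<psi> \<in> X"
  moreover from this have "\<psi> \<in> Irr G" using partition_onD1[OF partition_on_IrPt] by blast
  ultimately show "omega \<chi> (\<lambda>g. of_bool (g \<in> K)) = omega \<psi> (\<lambda>g. of_bool (g \<in> K))"
    using mem_IrPt_block_iff[OF assms] by blast
qed

lemma sigma_constant_ClPt: "sigma_constant XX (ClPt G XX)"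
  unfolding sigma_constant_def
proof (intro ballI)
  fix X K g h assume "X \<in> XX" "K \<in> ClPt G XX" "g \<in> K" "h \<in> K"
  moreover from this have "h \<in> carrier G" using partition_onD1[OF partition_on_ClPt] by blast
  ultimately show "sigma G X g = sigma G X h" using mem_ClPt_block_iff by blast
qed

lemma class_function_of_boolI:
  assumes K: "K \<subseteq> carrier G" and closed: "\<And>g h. g \<in> K \<Longrightarrow> h \<in> carrier G \<Longrightarrow> h \<otimes> g \<otimes> inv h \<in> K"
  shows "class_function (\<lambda>g. of_bool (g \<in> K))"
  unfolding class_function_def
proof (intro ballI)
  fix g h assume g: "g \<in> carrier G" and h: "h \<in> carrier G"
  have "g \<in> K" if "h \<otimes> g \<otimes> inv h \<in> K"
  proof -
    have "inv h \<otimes> (h \<otimes> g \<otimes> inv h) \<otimes> inv (inv h) = (inv h \<otimes> h) \<otimes> g \<otimes> (inv h \<otimes> h)"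
      using g h by (simp only: m_assoc m_closed inv_closed inv_inv)
    also have "\<dots> = g" using g h by simp
    finally show ?thesis using closed[OF that, of "inv h"] h by simp
  qed
  then show "(of_bool (h \<otimes> g \<otimes> inv h \<in> K) :: complex) = of_bool (g \<in> K)"
    using closed[OF _ h] by auto
qed

lemma normal_partition_if_G_invariant:
  assumes KK: "partition_on (carrier G) KK" and inv: "\<And>K. K \<in> KK \<Longrightarrow> G_invariant G K"
  shows "normal_partition KK"
  unfolding normal_partition_def
proof (intro conjI ballI KK class_function_of_boolI)
  fix K assume K: "K \<in> KK"
  show "K \<subseteq> carrier G" using K partition_onD1[OF KK] by auto
  fix g h assume g: "g \<in> K" and h: "h \<in> carrier G"
  obtain S where S: "S \<subseteq> carrier G" "K = (\<Union>g\<in>S. conj_class G g)" using inv[OF K] by (auto simp: G_invariant_def)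
  then obtain s x where s: "s \<in> S" "x \<in> carrier G" "g = x \<otimes> s \<otimes> inv x" using g by (auto simp: conj_class_def)
  then have sG: "s \<in> carrier G" using S(1) by auto
  have "h \<otimes> g \<otimes> inv h = (h \<otimes> x) \<otimes> s \<otimes> inv (h \<otimes> x)"
    using s(2,3) sG h by (simp add: m_assoc inv_mult_group)
  then have "h \<otimes> g \<otimes> inv h \<in> conj_class G s" using s(2) h by (auto simp: conj_class_def)
  then show "h \<otimes> g \<otimes> inv h \<in> K" using S(2) s(1) by auto
qed

text \<open>Conjugation does not change the values of the class functions \<open>\<sigma>\<^sub>X\<close>.\<close>

lemma normal_partition_ClPt:
  assumes XX: "\<And>X. X \<in> XX \<Longrightarrow> X \<subseteq> Irr G"
  shows "normal_partition (ClPt G XX)"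
  unfolding normal_partition_def
proof (intro conjI ballI partition_on_ClPt class_function_of_boolI)
  fix K assume K: "K \<in> ClPt G XX"
  show KG: "K \<subseteq> carrier G" using K partition_onD1[OF partition_on_ClPt] by auto
  fix g h assume g: "g \<in> K" and h: "h \<in> carrier G"
  have gG: "g \<in> carrier G" using g KG by auto
  have "sigma G X g = sigma G X (h \<otimes> g \<otimes> inv h)" if X: "X \<in> XX" for X
    using class_functionD[OF idem_coeff_class_function[OF XX[OF X]] gG h] by (simp add: idem_coeff_eq_iff_sigma_eq)
  then show "h \<otimes> g \<otimes> inv h \<in> K"
    using mem_ClPt_block_iff[OF K g] gG h by simp
qed

lemma supercharacter_theory_iff:
  assumes "partition_on (Irr G) XX" "partition_on (carrier G) KK"
  shows "supercharacter_theory G XX KK \<longleftrightarrow> card XX = card KK \<and> sigma_constant XX KK"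
  using assms by (simp add: supercharacter_theory_def sigma_constant_def)

end

section \<open>Comparison of partitions\<close>

theorem theorem1:
  fixes G :: "('a, 'b) monoid_scheme"
    and KK :: "'a set set"
    and XX :: "('a \<Rightarrow> complex) set set"
  assumes "group G" and "finite (carrier G)"
    and "partition_on (carrier G) KK" and "\<And>K. K \<in> KK \<Longrightarrow> G_invariant G K"
    and "partition_on (Irr G) XX"
  shows "(card KK \<le> card (IrPt G KK) \<and>
          (card KK = card (IrPt G KK) \<longleftrightarrow> supercharacter_theory G (IrPt G KK) KK)) \<and>
         (card XX \<le> card (ClPt G XX) \<and>
          (card XX = card (ClPt G XX) \<longleftrightarrow> supercharacter_theory G XX (ClPt G XX))) \<and>
         (refines (carrier G) (ClPt G (IrPt G KK)) KK \<and>
          (ClPt G (IrPt G KK) = KK \<longleftrightarrow> supercharacter_theory G (IrPt G KK) KK)) \<and>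
         (refines (Irr G) (IrPt G (ClPt G XX)) XX \<and>
          (IrPt G (ClPt G XX) = XX \<longleftrightarrow> supercharacter_theory G XX (ClPt G XX)))"
proof -
  interpret finite_group G
    using assms(1,2) by (simp add: finite_group_def finite_group_axioms_def)
  note KK = assms(3) and XX = assms(5)
  let ?I = "IrPt G KK" and ?C = "ClPt G XX"
  have Ip: "partition_on (Irr G) ?I" and Cp: "partition_on (carrier G) ?C"
    by (rule partition_on_IrPt, rule partition_on_ClPt)
  have nK: "normal_partition KK" by (rule normal_partition_if_G_invariant[OF KK assms(4)])
  have nC: "normal_partition ?C"
    by (rule normal_partition_ClPt) (use partition_onD1[OF XX] in auto)
  have omI: "omega_constant ?I KK" by (rule omega_constant_IrPt[OF KK])
  have siC: "sigma_constant XX ?C" by (rule sigma_constant_ClPt)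
  note sctI = supercharacter_theory_iff[OF Ip KK] and sctC = supercharacter_theory_iff[OF XX Cp]

  have a_le: "card KK \<le> card ?I" by (rule omega_constant_card(1)[OF nK Ip omI])
  have a_eq: "card KK = card ?I \<longleftrightarrow> supercharacter_theory G ?I KK"
    using omega_constant_card(2)[OF nK Ip omI] sctI by auto
  have b_le: "card XX \<le> card ?C" by (rule sigma_constant_card(1)[OF Cp XX siC])
  have b_eq: "card XX = card ?C \<longleftrightarrow> supercharacter_theory G XX ?C"
    using siC sctC by auto

  let ?CI = "ClPt G ?I"
  have CIp: "partition_on (carrier G) ?CI" by (rule partition_on_ClPt)
  have c_ref: "refines (carrier G) ?CI KK"
  proof (rule refinesI[OF CIp KK])
    fix L K g h assume L: "L \<in> ?CI" "g \<in> L" "h \<in> L" and K: "K \<in> KK" "g \<in> K"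
    have h: "h \<in> carrier G" using partition_onD1[OF CIp] L by auto
    show "h \<in> K"
      using mem_ClPt_block_iff[OF L(1,2) h] L(3) by (intro same_sigma_same_block[OF nK Ip omI K h]) auto
  qed
  have c_eq: "?CI = KK \<longleftrightarrow> supercharacter_theory G ?I KK"
  proof
    assume eq: "?CI = KK"
    then have si: "sigma_constant ?I KK" using sigma_constant_ClPt[of ?I] by simp
    \<comment> \<open>The cardinalities are compared in both directions: \<open>|\<K>| \<le> |IrPt \<K>|\<close> is (a), and constancy of the \<open>\<sigma>\<^sub>X\<close> gives the reverse.\<close>
    then show "supercharacter_theory G ?I KK"
      using sigma_constant_card(1)[OF KK Ip si] a_le sctI by simp
  next
    assume "supercharacter_theory G ?I KK"
    then have si: "sigma_constant ?I KK" using sctI by simp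
    have "refines (carrier G) KK ?CI"
    proof (rule refinesI[OF KK CIp])
      fix K L g h assume K: "K \<in> KK" "g \<in> K" "h \<in> K" and L: "L \<in> ?CI" "g \<in> L"
      have h: "h \<in> carrier G" using partition_onD1[OF KK] K by auto
      show "h \<in> L" using mem_ClPt_block_iff[OF L h] si K unfolding sigma_constant_def by blast
    qed
    with c_ref show "?CI = KK" by (rule refines_asym)
  qed

  let ?IC = "IrPt G ?C"
  have ICp: "partition_on (Irr G) ?IC" by (rule partition_on_IrPt)
  have d_ref: "refines (Irr G) ?IC XX"
  proof (rule refinesI[OF ICp XX])
    fix Y X \<chi> \<psi> assume Y: "Y \<in> ?IC" "\<chi> \<in> Y" "\<psi> \<in> Y" and X: "X \<in> XX" "\<chi> \<in> X"
    have \<psi>: "\<psi> \<in> Irr G" using partition_onD1[OF ICp] Y by auto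
    show "\<psi> \<in> X"
      using mem_IrPt_block_iff[OF Cp Y(1,2) \<psi>] Y(3)
      by (intro same_omega_same_block[OF Cp XX siC X \<psi>]) auto
  qed
  have d_eq: "?IC = XX \<longleftrightarrow> supercharacter_theory G XX ?C"
  proof
    assume eq: "?IC = XX"
    then have om: "omega_constant XX ?C" using omega_constant_IrPt[OF Cp] by simp
    \<comment> \<open>Here (b) is one of the two inequalities, and constancy of the central characters gives the other.\<close>
    then show "supercharacter_theory G XX ?C"
      using omega_constant_card(1)[OF nC XX om] b_le b_eq by simp
  next
    assume "supercharacter_theory G XX ?C"
    then have "card XX = card ?C" using sctC by simp
    then have om: "omega_constant XX ?C" by (rule sigma_constant_card(2)[OF Cp XX siC])
    have "refines (Irr G) XX ?IC"
    proof (rule refinesI[OF XX ICp])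
      fix X Y \<chi> \<psi> assume X: "X \<in> XX" "\<chi> \<in> X" "\<psi> \<in> X" and Y: "Y \<in> ?IC" "\<chi> \<in> Y"
      have \<psi>: "\<psi> \<in> Irr G" using partition_onD1[OF XX] X by auto
      show "\<psi> \<in> Y" using mem_IrPt_block_iff[OF Cp Y \<psi>] om X unfolding omega_constant_def by blast
    qed
    with d_ref show "?IC = XX" by (rule refines_asym)
  qed

  show ?thesis using a_le a_eq b_le b_eq c_ref c_eq d_ref d_eq by blast
qed

end
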